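(* For every positive integer $n$, the number of elements in the congruence lattice of the slow Tamari lattice $\operatorname{sTam}_n$ equals the sum, over all Dyck paths from $(0,0)$ to $(2n,0)$, of the weight of the path, where the weight of a Dyck path is the product of the weights $\operatorname{wt}(c)$ of all cells $c$ below the path, with $$\operatorname{wt}(c)=\begin{cases}1&\text{if } c\text{ is any cell of height }1,\\3&\text{if } c\text{ is a corner cell of height}>1,\\2&\text{if } c\text{ is a boundary cell of height}>1,\\1&\text{if } c\text{ is an inner cell of height}>1.\end{cases}$$
   Context: Let $n$ be a positive integer. The board of size $n$ is the Ferrers diagram of shape $(n,n,n-1,n-2,\dots,3,2)$ (a single cell $(1,1)$ if $n=1$). Its cells are written $(i,j)$, where $i$ is the row, numbered from the top, and $j$ is the column label, the columns being labelled $n,n-1,\dots,1$ from left to right. So the cells are $(1,j)$ for $1\le j\le n$ and $(i,j)$ for $2\le i\le n$, $i-1\le j\le n$. The root is $(1,n)$ (top-left cell); the border cells are $(i,i-1)$ for $2\le i\le n$ (the rightmost cells of rows $2,\dots,n$). An fb-tableau of size $n$ is a filling in which each cell is either empty or nonempty such that the root and all border cells are nonempty, and every nonempty cell other than the root has a nonempty cell strictly to its left in the same row or strictly above it in the same column. In an fb-tableau, a nonempty cell different from the root is called a left-arrow if there is no nonempty cell strictly to its left in its row, an up-arrow if there is no nonempty cell strictly above it in its column, and a dot otherwise; the root is also a dot. (Each of rows $2,\dots,n$ has exactly one left-arrow, each of columns $1,\dots,n-1$ has exactly one up-arrow.) A cell is free in $T$ if it lies strictly below an up-arrow (same column) and strictly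 to the right of a left-arrow (same row); a free cell is either empty or contains a dot. $\operatorname{Row}(T)$ is the set of cells lying weakly to the right of a left-arrow or of the root in the same row; $\operatorname{Col}(T)$ is the set of cells lying weakly below an up-arrow or the root in the same column. For fb-tableaux $S,T$ of size $n$, write $S\lhd T$ if (1) $\operatorname{Col}(S)\subseteq\operatorname{Col}(T)$; (2) $\operatorname{Row}(T)\subseteq\operatorname{Row}(S)$; (3) for every cell $c$ that is free in both $S$ and $T$, if $c$ contains a dot in $S$ then $c$ contains a dot in $T$. An fb-tableau is small if its only dot is the root (equivalently, all its free cells are empty). The slow Tamari lattice $\operatorname{sTam}_n$ is the set of small fb-tableaux of size $n$ ordered by $\lhd$; it is a finite lattice. A congruence of a lattice is an equivalence relation compatible with $\wedge$ and $\vee$; the congruence lattice is the set of all congruences ordered by inclusion. Dyck paths: steps $(1,1)$ and $(1,-1)$, from $(0,0)$ to $(2n,0)$, never going below the $x$-axis. A cell (of the path picture) is a unit diamond with vertices $(a,h-1),(a-1,h),(a,h+1),(a+1,h)$, with $a,h$ integers, $h\ge1$ and $a+h$ odd; $h$ is its height. It is below the path if it lies weakly below the path, i.e. the height of the path at abscissa $a$ is at least $h+1$. A cell below the path is a corner cell if both of its upper edges (the segments from $(a-1,h)$ to $(a,h+1)$ and from $(a,h+1)$ to $(a+1,h)$) are steps of the path, a boundary cell if exactly one of them is, and an inner cell if neither is. *)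

theory Defs
  imports Main "HOL-Algebra.Lattice"
begin

section \<open>fb-tableaux\<close>

text \<open>
  A cell \<open>(i, j)\<close> lies in row \<open>i\<close>, counted from the top, and in the column labelled \<open>j\<close>.
  Column labels decrease from left to right, so within a row ``to the left'' means a
  \<^emph>\<open>larger\<close> \<open>j\<close>.
\<close>

type_synonym cell = "nat \<times> nat"

definition board :: "nat \<Rightarrow> cell set" where
  "board n = {(1, j) | j. 1 \<le> j \<and> j \<le> n} \<union> {(i, j) | i j. 2 \<le> i \<and> i \<le> n \<and> i - 1 \<le> j \<and> j \<le> n}"

definition root :: "nat \<Rightarrow> cell" where
  "root n = (1, n)"

definition border :: "nat \<Rightarrow> cell set" where
  "border n = {(i, i - 1) | i. 2 \<le> i \<and> i \<le> n}"

definition left_of :: "cell \<Rightarrow> cell \<Rightarrow> bool" where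
  "left_of d c \<longleftrightarrow> fst d = fst c \<and> snd d > snd c"

definition above :: "cell \<Rightarrow> cell \<Rightarrow> bool" where
  "above d c \<longleftrightarrow> snd d = snd c \<and> fst d < fst c"

text \<open>A filling is represented by its set of nonempty cells.\<close>

definition fb_tableau :: "nat \<Rightarrow> cell set \<Rightarrow> bool" where
  "fb_tableau n T \<longleftrightarrow>
     T \<subseteq> board n \<and> root n \<in> T \<and> border n \<subseteq> T \<and>
     (\<forall>c\<in>T. c \<noteq> root n \<longrightarrow> (\<exists>d\<in>T. left_of d c \<or> above d c))"

definition left_arrow :: "nat \<Rightarrow> cell set \<Rightarrow> cell \<Rightarrow> bool" where
  "left_arrow n T c \<longleftrightarrow> c \<in> T \<and> c \<noteq> root n \<and> \<not> (\<exists>d\<in>T. left_of d c)"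

definition up_arrow :: "nat \<Rightarrow> cell set \<Rightarrow> cell \<Rightarrow> bool" where
  "up_arrow n T c \<longleftrightarrow> c \<in> T \<and> c \<noteq> root n \<and> \<not> (\<exists>d\<in>T. above d c)"

definition dot :: "nat \<Rightarrow> cell set \<Rightarrow> cell \<Rightarrow> bool" where
  "dot n T c \<longleftrightarrow> c \<in> T \<and> \<not> left_arrow n T c \<and> \<not> up_arrow n T c"

definition free_cell :: "nat \<Rightarrow> cell set \<Rightarrow> cell \<Rightarrow> bool" where
  "free_cell n T c \<longleftrightarrow>
     c \<in> board n \<and> (\<exists>u. up_arrow n T u \<and> above u c) \<and> (\<exists>l. left_arrow n T l \<and> left_of l c)"

definition Row :: "nat \<Rightarrow> cell set \<Rightarrow> cell set" where
  "Row n T = {c \<in> board n. \<exists>d. (left_arrow n T d \<or> d = root n) \<and> (d = c \<or> left_of d c)}"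

definition Col :: "nat \<Rightarrow> cell set \<Rightarrow> cell set" where
  "Col n T = {c \<in> board n. \<exists>d. (up_arrow n T d \<or> d = root n) \<and> (d = c \<or> above d c)}"

definition fb_le :: "nat \<Rightarrow> cell set \<Rightarrow> cell set \<Rightarrow> bool" where
  "fb_le n S T \<longleftrightarrow>
     Col n S \<subseteq> Col n T \<and> Row n T \<subseteq> Row n S \<and>
     (\<forall>c. free_cell n S c \<and> free_cell n T c \<longrightarrow> dot n S c \<longrightarrow> dot n T c)"

definition small :: "nat \<Rightarrow> cell set \<Rightarrow> bool" where
  "small n T \<longleftrightarrow> {c. dot n T c} = {root n}"

definition sTam :: "nat \<Rightarrow> cell set gorder" where
  "sTam n = \<lparr>carrier = {T. fb_tableau n T \<and> small n T}, eq = (=), le = fb_le n\<rparr>"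


section \<open>Lattice congruences\<close>

definition lattice_congruence :: "('a, 'b) gorder_scheme \<Rightarrow> ('a \<times> 'a) set \<Rightarrow> bool" where
  "lattice_congruence L R \<longleftrightarrow>
     equiv (carrier L) R \<and>
     (\<forall>x x' y y'. (x, x') \<in> R \<longrightarrow> (y, y') \<in> R \<longrightarrow>
        (x \<sqinter>\<^bsub>L\<^esub> y, x' \<sqinter>\<^bsub>L\<^esub> y') \<in> R \<and> (x \<squnion>\<^bsub>L\<^esub> y, x' \<squnion>\<^bsub>L\<^esub> y') \<in> R)"

definition congruence_lattice :: "('a, 'b) gorder_scheme \<Rightarrow> ('a \<times> 'a) set gorder" where
  "congruence_lattice L = \<lparr>carrier = {R. lattice_congruence L R}, eq = (=), le = (\<subseteq>)\<rparr>"


section \<open>Weighted Dyck paths\<close>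

text \<open>
  A path is the list of the vertical components \<open>1\<close>, \<open>-1\<close> of its steps.
\<close>

definition height_at :: "int list \<Rightarrow> nat \<Rightarrow> int" where
  "height_at p k = sum_list (take k p)"

definition dyck_path :: "nat \<Rightarrow> int list \<Rightarrow> bool" where
  "dyck_path n p \<longleftrightarrow>
     set p \<subseteq> {1, -1} \<and> length p = 2 * n \<and>
     (\<forall>k \<le> 2 * n. height_at p k \<ge> 0) \<and> height_at p (2 * n) = 0"

definition path_steps :: "int list \<Rightarrow> ((int \<times> int) \<times> (int \<times> int)) set" where
  "path_steps p =
     {((int k, height_at p k), (int (Suc k), height_at p (Suc k))) | k. k < length p}"

text \<open>
  The diamond with vertices \<open>(a, h - 1)\<close>, \<open>(a - 1, h)\<close>, \<open>(a, h + 1)\<close>, \<open>(a + 1, h)\<close> is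
  represented by its centre \<open>(a, h)\<close>; its height is \<open>h\<close>.
\<close>

definition cells_below :: "int list \<Rightarrow> (int \<times> int) set" where
  "cells_below p =
     {(a, h). h \<ge> 1 \<and> odd (a + h) \<and> 0 \<le> a \<and> a \<le> int (length p) \<and> height_at p (nat a) \<ge> h + 1}"

definition upper_left_edge :: "int \<times> int \<Rightarrow> (int \<times> int) \<times> (int \<times> int)" where
  "upper_left_edge = (\<lambda>(a, h). ((a - 1, h), (a, h + 1)))"

definition upper_right_edge :: "int \<times> int \<Rightarrow> (int \<times> int) \<times> (int \<times> int)" where
  "upper_right_edge = (\<lambda>(a, h). ((a, h + 1), (a + 1, h)))"

definition corner_cell :: "int list \<Rightarrow> int \<times> int \<Rightarrow> bool" where
  "corner_cell p c \<longleftrightarrow> upper_left_edge c \<in> path_steps p \<and> upper_right_edge c \<in> path_steps p"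

definition boundary_cell :: "int list \<Rightarrow> int \<times> int \<Rightarrow> bool" where
  "boundary_cell p c \<longleftrightarrow>
     (upper_left_edge c \<in> path_steps p) \<noteq> (upper_right_edge c \<in> path_steps p)"

definition wt :: "int list \<Rightarrow> int \<times> int \<Rightarrow> nat" where
  "wt p c =
     (if snd c = 1 then 1
      else if corner_cell p c then 3
      else if boundary_cell p c then 2
      else 1)"

definition path_weight :: "int list \<Rightarrow> nat" where
  "path_weight p = (\<Prod>c\<in>cells_below p. wt p c)"

end

theory Submission
  imports Defs
begin

text \<open>
  A small fb-tableau is determined by the function sending \<open>k \<in> {1..n-1}\<close> to \<open>b > k\<close> if the left-arrow
  of row \<open>k + 1\<close> sits in column \<open>b\<close>, and to \<open>a < k\<close> if the up-arrow of column \<open>k\<close> sits in row \<open>a + 1\<close>;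
  for each \<open>k\<close> exactly one of the two arrows is the border cell \<open>(k + 1, k)\<close>. In this
  encoding the order \<open>\<lhd>\<close> becomes the reverse of the pointwise order, and the joins can be written
  down explicitly.

  Every congruence is determined by the set of conditions \<open>f k \<le> v\<close> that are constant on its classes,
  and the sets that occur are described by local closure rules. Attach to a cell of the Dyck path
  picture the interval \<open>[i, j]\<close> cut out by the two lattice lines through it; it carries the two
  conditions \<open>f i \<le> j\<close> and \<open>f j \<le> i - 1\<close>, which are equivalent if \<open>i = j\<close> (height 1). If one of the
  conditions at \<open>[i, j]\<close> is respected, then so are the first one at \<open>[i, j - 1]\<close> and the second one at
  \<open>[i + 1, j]\<close>. Hence the cells with a respected condition are those below a Dyck path, and the
  free choices at a corner, boundary or inner cell number 3, 2 and 1.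
\<close>

section \<open>The lattice of arrow functions\<close>

text \<open>The last two clauses say that an arrow cell off the border is supported: the up-arrow in
  row \<open>f k + 1\<close> of column \<open>k\<close> needs the left-arrow of that row to its
  left, and the left-arrow of row \<open>k + 1\<close> in column \<open>f k\<close> needs the
  up-arrow of that column above it. For the values \<open>0\<close> and \<open>n\<close> the root
  gives the support. The default \<open>0\<close> makes equality and order of functions those of the
  encoded data.\<close>

definition arrow_funs :: "nat \<Rightarrow> (nat \<Rightarrow> nat) set" where
  "arrow_funs n = {f. (\<forall>k. \<not> (0 < k \<and> k < n) \<longrightarrow> f k = 0) \<and>
     (\<forall>k. 0 < k \<and> k < n \<longrightarrow> f k \<le> n \<and> f k \<noteq> k \<and>
        (0 < f k \<and> f k < k \<longrightarrow> k < f (f k)) \<and> (k < f k \<and> f k < n \<longrightarrow> f (f k) < k))}"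

lemma arrow_funsI:
  assumes "\<And>k. \<not> (0 < k \<and> k < n) \<Longrightarrow> f k = 0"
    and "\<And>k. \<lbrakk>0 < k; k < n\<rbrakk> \<Longrightarrow> f k \<le> n"
    and "\<And>k. \<lbrakk>0 < k; k < n\<rbrakk> \<Longrightarrow> f k \<noteq> k"
    and "\<And>k. \<lbrakk>0 < k; k < n; 0 < f k; f k < k\<rbrakk> \<Longrightarrow> k < f (f k)"
    and "\<And>k. \<lbrakk>0 < k; k < n; k < f k; f k < n\<rbrakk> \<Longrightarrow> f (f k) < k"
  shows "f \<in> arrow_funs n"
  using assms unfolding arrow_funs_def by blast

lemma arrow_funsD:
  assumes "f \<in> arrow_funs n"
  shows "\<not> (0 < k \<and> k < n) \<Longrightarrow> f k = 0"
    and "f k \<le> n"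
    and "\<lbrakk>0 < k; k < n\<rbrakk> \<Longrightarrow> f k \<noteq> k"
    and "\<lbrakk>k < n; 0 < f k; f k < k\<rbrakk> \<Longrightarrow> k < f (f k)"
    and "\<lbrakk>k < f k; f k < n\<rbrakk> \<Longrightarrow> f (f k) < k"
proof -
  show 1: "f k = 0" if "\<not> (0 < k \<and> k < n)" for k
    using assms that unfolding arrow_funs_def by blast
  show "f k \<le> n"
    using assms 1[of k] unfolding arrow_funs_def by (cases "0 < k \<and> k < n") auto
  show "\<lbrakk>0 < k; k < n\<rbrakk> \<Longrightarrow> f k \<noteq> k" "\<lbrakk>k < n; 0 < f k; f k < k\<rbrakk> \<Longrightarrow> k < f (f k)"
    using assms unfolding arrow_funs_def by auto
  show "f (f k) < k" if "k < f k" "f k < n"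
  proof -
    have "0 < k \<and> k < n" using that 1[of k] by linarith
    then show ?thesis using assms that unfolding arrow_funs_def by blast
  qed
qed

lemma arrow_fun_le:
  assumes "f \<in> arrow_funs n" and "\<And>k. \<lbrakk>0 < k; k < n\<rbrakk> \<Longrightarrow> f k \<le> g k"
  shows "f \<le> g"
  using assms(2) arrow_funsD(1)[OF assms(1)] by (metis le_funI zero_le)

lemma finite_arrow_funs: "finite (arrow_funs n)"
proof (rule finite_subset)
  show "arrow_funs n \<subseteq> {f. (\<forall>k. (k \<in> {0<..<n} \<longrightarrow> f k \<in> {..n}) \<and> (k \<notin> {0<..<n} \<longrightarrow> f k = 0))}"
    by (auto simp: arrow_funs_def)
  show "finite {f :: nat \<Rightarrow> nat. (\<forall>k. (k \<in> {0<..<n} \<longrightarrow> f k \<in> {..n}) \<and> (k \<notin> {0<..<n} \<longrightarrow> f k = 0))}"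
    by (rule finite_set_of_finite_funs) auto
qed

text \<open>
  Transposition of tableaux, which reverses the order; this duality produces meets from joins.
\<close>

definition reflect :: "nat \<Rightarrow> (nat \<Rightarrow> nat) \<Rightarrow> nat \<Rightarrow> nat" where
  "reflect n f k = (if 0 < k \<and> k < n then n - f (n - k) else 0)"

text \<open>Replacing positions \<open>k\<close> by \<open>n - k\<close> and values \<open>v\<close>
  by \<open>n - v\<close> reverses inequalities, so the two support clauses trade places.\<close>

lemma reflect_arrow_funs:
  assumes "f \<in> arrow_funs n"
  shows "reflect n f \<in> arrow_funs n"
proof (rule arrow_funsI)
  note D = arrow_funsD[OF assms]
  fix k assume k: "0 < k" "k < n"
  have r: "reflect n f k = n - f (n - k)" using k by (simp add: reflect_def)
  show "reflect n f k \<noteq> k"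
    using k D(2,3)[of "n - k"] by (auto simp: reflect_def)
  show "k < reflect n f (reflect n f k)" if "0 < reflect n f k" "reflect n f k < k"
  proof -
    have e: "n - reflect n f k = f (n - k)" "n - k < f (n - k)" "f (n - k) < n"
      using k that D(2)[of "n - k"] unfolding r by linarith+
    then have "f (f (n - k)) < n - k" using D(5) by blast
    then show ?thesis using e that k by (simp add: reflect_def)
  qed
  show "reflect n f (reflect n f k) < k" if "k < reflect n f k" "reflect n f k < n"
  proof -
    have e: "n - reflect n f k = f (n - k)" "0 < f (n - k)" "f (n - k) < n - k"
      using k that D(2)[of "n - k"] unfolding r by linarith+
    then have "n - k < f (f (n - k))" using D(4)[of "n - k"] k by auto
    then have "n - f (f (n - k)) < k" using k by linarith
    then show ?thesis using e that k by (simp add: reflect_def)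
  qed
qed (auto simp: reflect_def)

lemma reflect_reflect:
  assumes "f \<in> arrow_funs n"
  shows "reflect n (reflect n f) = f"
proof
  fix k show "reflect n (reflect n f) k = f k"
    using arrow_funsD(1,2)[OF assms, of k] by (auto simp: reflect_def)
qed

lemma reflect_le:
  assumes "f \<le> g"
  shows "reflect n g \<le> reflect n f"
  using assms by (auto simp: reflect_def le_fun_def diff_le_mono2)

section \<open>Joins and meets of arrow functions\<close>

text \<open>If one of the values at \<open>k\<close> exceeds \<open>k\<close>, so must the join; a
  value \<open>b < n\<close> then forces the join at \<open>b\<close> below \<open>k\<close>, hence
  also \<open>f b\<close> and \<open>g b\<close>. The least \<open>b\<close> meeting these necessary
  demands turns out to work; \<open>n\<close> always qualifies.\<close>

definition arrow_join :: "nat \<Rightarrow> (nat \<Rightarrow> nat) \<Rightarrow> (nat \<Rightarrow> nat) \<Rightarrow> nat \<Rightarrow> nat" where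
  "arrow_join n f g k =
     (if \<not> (0 < k \<and> k < n) then 0
      else if f k < k \<and> g k < k then max (f k) (g k)
      else LEAST b. f k \<le> b \<and> g k \<le> b \<and> (b = n \<or> f b < k \<and> g b < k))"

definition arrow_meet :: "nat \<Rightarrow> (nat \<Rightarrow> nat) \<Rightarrow> (nat \<Rightarrow> nat) \<Rightarrow> nat \<Rightarrow> nat" where
  "arrow_meet n f g = reflect n (arrow_join n (reflect n f) (reflect n g))"

lemma arrow_join_commute: "arrow_join n f g = arrow_join n g f"
  by (rule ext) (simp add: arrow_join_def max.commute conj_ac)

context
  fixes n f g
  assumes f: "f \<in> arrow_funs n" and g: "g \<in> arrow_funs n"
begin

lemma arrow_join_inner:
  assumes "0 < k" "k < n" "f k < k" "g k < k"
  shows "arrow_join n f g k = max (f k) (g k)"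
  using assms by (simp add: arrow_join_def)

lemma arrow_join_outer:
  assumes "0 < k" "k < n" "\<not> (f k < k \<and> g k < k)"
  defines "b \<equiv> arrow_join n f g k"
  shows "f k \<le> b" "g k \<le> b" "b = n \<or> f b < k \<and> g b < k"
    "\<And>c. \<lbrakk>f k \<le> c; g k \<le> c; c = n \<or> f c < k \<and> g c < k\<rbrakk> \<Longrightarrow> b \<le> c" "b \<le> n" "k < b"
proof -
  let ?P = "\<lambda>b. f k \<le> b \<and> g k \<le> b \<and> (b = n \<or> f b < k \<and> g b < k)"
  have b: "b = Least ?P" using assms by (simp only: b_def arrow_join_def) auto
  have n: "?P n" using arrow_funsD(2)[OF f] arrow_funsD(2)[OF g] by blast
  show P: "f k \<le> b" "g k \<le> b" "b = n \<or> f b < k \<and> g b < k"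
    unfolding b using LeastI[of ?P, OF n] by blast+
  show "\<And>c. \<lbrakk>f k \<le> c; g k \<le> c; c = n \<or> f c < k \<and> g c < k\<rbrakk> \<Longrightarrow> b \<le> c"
    unfolding b by (rule Least_le) blast
  show "b \<le> n" unfolding b by (rule Least_le[of ?P, OF n])
  show "k < b"
    using P(1,2) arrow_funsD(3)[OF f assms(1,2)] arrow_funsD(3)[OF g assms(1,2)] assms(3)
    by linarith
qed

lemma arrow_join_upper: "f \<le> arrow_join n f g" "g \<le> arrow_join n f g"
proof -
  have "f k \<le> arrow_join n f g k \<and> g k \<le> arrow_join n f g k" if "0 < k" "k < n" for k
    using arrow_join_outer(1,2)[OF that] arrow_join_inner[OF that]
    by (cases "f k < k \<and> g k < k") auto
  then show "f \<le> arrow_join n f g" "g \<le> arrow_join n f g"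
    using arrow_fun_le[OF f] arrow_fun_le[OF g] by blast+
qed

lemma arrow_join_closed: "arrow_join n f g \<in> arrow_funs n"
proof (rule arrow_funsI)
  let ?m = "arrow_join n f g"
  show "\<not> (0 < k \<and> k < n) \<Longrightarrow> ?m k = 0" for k by (simp add: arrow_join_def)
  fix k assume k: "0 < k" "k < n"
  show "?m k \<le> n" "?m k \<noteq> k"
    using arrow_join_outer(5,6)[OF k] arrow_join_inner[OF k] k
    by (cases "f k < k \<and> g k < k"; force)+
  show "k < ?m (?m k)" if m: "0 < ?m k" "?m k < k"
  proof -
    have lt: "f k < k" "g k < k" using arrow_join_outer(6)[OF k] m(2) by force+
    then have "?m k = f k \<or> ?m k = g k" using arrow_join_inner[OF k] by (auto simp: max_def)
    \<comment> \<open>The maximum is the value of \<open>f\<close> or of \<open>g\<close>, and the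
      support clause of that function survives because the join lies above it.\<close>
    then have "k < f (?m k) \<or> k < g (?m k)"
      using arrow_funsD(4)[OF f k(2)] arrow_funsD(4)[OF g k(2)] m by metis
    then show ?thesis using arrow_join_upper by (meson le_funD less_le_trans)
  qed
  show "?m (?m k) < k" if m: "k < ?m k" "?m k < n"
  proof -
    have "\<not> (f k < k \<and> g k < k)" using arrow_join_inner[OF k] m(1) by force
    \<comment> \<open>By the choice of \<open>b\<close> both functions are below \<open>k\<close> at
      \<open>b > k\<close>, so the join at \<open>b\<close> is a maximum of two values below
      \<open>k\<close>.\<close>
    then have "f (?m k) < k" "g (?m k) < k" using arrow_join_outer(3)[OF k] m(2) by auto
    then show ?thesis using arrow_join_inner[of "?m k"] m by auto
  qed
qed

text \<open>Where the join is not a maximum, an upper bound \<open>h\<close> has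
  \<open>h k > k\<close>, and the support clause of \<open>h\<close> makes \<open>h k\<close> one of
  the candidates among which the join takes the least.\<close>

lemma arrow_join_least:
  assumes h: "h \<in> arrow_funs n" "f \<le> h" "g \<le> h"
  shows "arrow_join n f g \<le> h"
proof (rule arrow_fun_le[OF arrow_join_closed])
  fix k assume k: "0 < k" "k < n"
  have fg: "f j \<le> h j" "g j \<le> h j" for j using h by (auto simp: le_fun_def)
  show "arrow_join n f g k \<le> h k"
  proof (cases "f k < k \<and> g k < k")
    case True
    then show ?thesis using arrow_join_inner[OF k] fg[of k] by simp
  next
    case False
    have "k < h k" using False fg[of k] arrow_funsD(3)[OF h(1) k] by auto
    then have "h k = n \<or> h (h k) < k"
      using arrow_funsD(2,5)[OF h(1)] by (metis le_neq_implies_less)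
    then have "h k = n \<or> f (h k) < k \<and> g (h k) < k" using fg[of "h k"] by auto
    then show ?thesis using arrow_join_outer(4)[OF k False] fg[of k] by blast
  qed
qed

lemma arrow_join_le_iff_inner:
  assumes "0 < k" "k < n" "v < k"
  shows "arrow_join n f g k \<le> v \<longleftrightarrow> f k \<le> v \<and> g k \<le> v"
  using arrow_join_inner[OF assms(1,2)] arrow_join_outer(6)[OF assms(1,2)] assms(3)
  by (cases "f k < k \<and> g k < k") auto

text \<open>Expresses a condition on the join through conditions on its arguments, which is how
  congruences are checked later. If both values at \<open>k\<close> are below \<open>k\<close>, the
  witness is \<open>b = k\<close>; otherwise it is the value of the join.\<close>

lemma arrow_join_le_iff_outer:
  assumes k: "0 < k" "k \<le> v" "v < n"
  shows "arrow_join n f g k \<le> v \<longleftrightarrow> (\<exists>b\<ge>k. b \<le> v \<and> f k \<le> b \<and> g k \<le> b \<and> f b < k \<and> g b < k)"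
    (is "?l \<longleftrightarrow> ?r")
proof (cases "f k < k \<and> g k < k")
  case True
  then show ?thesis using arrow_join_inner[of k] k by auto
next
  case False
  have k2: "k < n" using k by simp
  note o = arrow_join_outer[OF k(1) k2 False]
  show ?thesis
  proof
    assume ?l
    then show ?r using o(1-3,6) k by (intro exI[of _ "arrow_join n f g k"]) auto
  next
    assume ?r
    then show ?l using o(4) by (meson le_trans)
  qed
qed

end

lemma arrow_meet_closed:
  assumes "f \<in> arrow_funs n" "g \<in> arrow_funs n"
  shows "arrow_meet n f g \<in> arrow_funs n"
  unfolding arrow_meet_def using assms by (intro reflect_arrow_funs arrow_join_closed)

lemma arrow_meet_lower:
  assumes f: "f \<in> arrow_funs n" and g: "g \<in> arrow_funs n"
  shows "arrow_meet n f g \<le> f" "arrow_meet n f g \<le> g"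
  using reflect_le[OF arrow_join_upper(1)[OF reflect_arrow_funs[OF f] reflect_arrow_funs[OF g]], of n]
    reflect_le[OF arrow_join_upper(2)[OF reflect_arrow_funs[OF f] reflect_arrow_funs[OF g]], of n]
    reflect_reflect[OF f] reflect_reflect[OF g]
  unfolding arrow_meet_def by simp_all

lemma arrow_meet_greatest:
  assumes f: "f \<in> arrow_funs n" and g: "g \<in> arrow_funs n"
    and h: "h \<in> arrow_funs n" "h \<le> f" "h \<le> g"
  shows "h \<le> arrow_meet n f g"
  using reflect_le[OF arrow_join_least[OF reflect_arrow_funs[OF f] reflect_arrow_funs[OF g]
        reflect_arrow_funs[OF h(1)] reflect_le[OF h(2)] reflect_le[OF h(3)]], of n]
    reflect_reflect[OF h(1)]
  unfolding arrow_meet_def by simp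

lemma arrow_join_absorb:
  assumes "f \<in> arrow_funs n" "g \<in> arrow_funs n" "g \<le> f"
  shows "arrow_join n f g = f"
  using assms arrow_join_upper arrow_join_least by (meson order.antisym order.refl)

lemma arrow_meet_absorb:
  assumes "f \<in> arrow_funs n" "g \<in> arrow_funs n" "f \<le> g"
  shows "arrow_meet n f g = f"
  using assms arrow_meet_lower arrow_meet_greatest by (meson order.antisym order.refl)

lemma reflect_join:
  assumes "f \<in> arrow_funs n" "g \<in> arrow_funs n"
  shows "reflect n (arrow_join n f g) = arrow_meet n (reflect n f) (reflect n g)"
  unfolding arrow_meet_def using assms by (simp add: reflect_reflect)

lemma reflect_meet:
  assumes "f \<in> arrow_funs n" "g \<in> arrow_funs n"
  shows "reflect n (arrow_meet n f g) = arrow_join n (reflect n f) (reflect n g)"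
  unfolding arrow_meet_def using assms
  by (intro reflect_reflect arrow_join_closed reflect_arrow_funs)

section \<open>Congruences and closed sets of conditions\<close>

definition arrow_congs :: "nat \<Rightarrow> ((nat \<Rightarrow> nat) \<times> (nat \<Rightarrow> nat)) set set" where
  "arrow_congs n = {R. equiv (arrow_funs n) R \<and>
     (\<forall>f f' g g'. (f, f') \<in> R \<longrightarrow> (g, g') \<in> R \<longrightarrow>
        (arrow_meet n f g, arrow_meet n f' g') \<in> R \<and> (arrow_join n f g, arrow_join n f' g') \<in> R)}"

lemma arrow_congsD:
  assumes "R \<in> arrow_congs n"
  shows "(f, g) \<in> R \<Longrightarrow> f \<in> arrow_funs n" "(f, g) \<in> R \<Longrightarrow> g \<in> arrow_funs n"
    "f \<in> arrow_funs n \<Longrightarrow> (f, f) \<in> R"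
    "(f, g) \<in> R \<Longrightarrow> (g, f) \<in> R"
    "\<lbrakk>(f, g) \<in> R; (g, h) \<in> R\<rbrakk> \<Longrightarrow> (f, h) \<in> R"
    "\<lbrakk>(f, f') \<in> R; (g, g') \<in> R\<rbrakk> \<Longrightarrow> (arrow_meet n f g, arrow_meet n f' g') \<in> R"
    "\<lbrakk>(f, f') \<in> R; (g, g') \<in> R\<rbrakk> \<Longrightarrow> (arrow_join n f g, arrow_join n f' g') \<in> R"
proof -
  have e: "equiv (arrow_funs n) R" using assms by (simp add: arrow_congs_def)
  show "(f, g) \<in> R \<Longrightarrow> f \<in> arrow_funs n" "(f, g) \<in> R \<Longrightarrow> g \<in> arrow_funs n"
    "f \<in> arrow_funs n \<Longrightarrow> (f, f) \<in> R"
    "(f, g) \<in> R \<Longrightarrow> (g, f) \<in> R"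
    "\<lbrakk>(f, g) \<in> R; (g, h) \<in> R\<rbrakk> \<Longrightarrow> (f, h) \<in> R"
    using equiv_type[OF e] e unfolding equiv_def refl_on_def by (blast dest: symD transD)+
  show "\<lbrakk>(f, f') \<in> R; (g, g') \<in> R\<rbrakk> \<Longrightarrow> (arrow_meet n f g, arrow_meet n f' g') \<in> R"
    "\<lbrakk>(f, f') \<in> R; (g, g') \<in> R\<rbrakk> \<Longrightarrow> (arrow_join n f g, arrow_join n f' g') \<in> R"
    using assms by (simp_all add: arrow_congs_def)
qed

text \<open>The pair \<open>(k, v)\<close> stands for \<open>f k \<le> v\<close>; for
  \<open>v \<ge> n\<close> this would hold for every arrow function.\<close>

definition conditions :: "nat \<Rightarrow> (nat \<times> nat) set" where
  "conditions n = {(k, v). 0 < k \<and> k < n \<and> v < n}"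

definition respected :: "nat \<Rightarrow> ((nat \<Rightarrow> nat) \<times> (nat \<Rightarrow> nat)) set \<Rightarrow> (nat \<times> nat) set" where
  "respected n R = {(k, v) \<in> conditions n. \<forall>(f, g)\<in>R. f k \<le> v \<longleftrightarrow> g k \<le> v}"

definition agreement :: "nat \<Rightarrow> (nat \<times> nat) set \<Rightarrow> ((nat \<Rightarrow> nat) \<times> (nat \<Rightarrow> nat)) set" where
  "agreement n N = {(f, g). f \<in> arrow_funs n \<and> g \<in> arrow_funs n \<and> (\<forall>(k, v)\<in>N. f k \<le> v \<longleftrightarrow> g k \<le> v)}"

text \<open>The first rule reflects \<open>f k \<noteq> k\<close>. In the second,
  \<open>(i, j)\<close> and \<open>(j, i - 1)\<close> are the two conditions at the interval
  \<open>[i, j]\<close>, while \<open>(i, j - 1)\<close> and \<open>(j, i)\<close> belong to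
  \<open>[i, j - 1]\<close> and \<open>[i + 1, j]\<close>.\<close>

definition closed_conditions :: "nat \<Rightarrow> (nat \<times> nat) set set" where
  "closed_conditions n = {N. N \<subseteq> conditions n \<and>
     (\<forall>k. 0 < k \<and> k < n \<longrightarrow> ((k, k) \<in> N \<longleftrightarrow> (k, k - 1) \<in> N)) \<and>
     (\<forall>i j. 0 < i \<and> i < j \<and> j < n \<and> ((i, j) \<in> N \<or> (j, i - 1) \<in> N) \<longrightarrow> (i, j - 1) \<in> N \<and> (j, i) \<in> N)}"

lemma closed_conditionsD:
  assumes "N \<in> closed_conditions n"
  shows "(k, v) \<in> N \<Longrightarrow> 0 < k \<and> k < n \<and> v < n"
    and "\<lbrakk>0 < k; k < n\<rbrakk> \<Longrightarrow> (k, k) \<in> N \<longleftrightarrow> (k, k - 1) \<in> N"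
    and "\<lbrakk>0 < i; i < j; j < n; (i, j) \<in> N \<or> (j, i - 1) \<in> N\<rbrakk> \<Longrightarrow> (i, j - 1) \<in> N"
    and "\<lbrakk>0 < i; i < j; j < n; (i, j) \<in> N \<or> (j, i - 1) \<in> N\<rbrakk> \<Longrightarrow> (j, i) \<in> N"
  using assms unfolding closed_conditions_def conditions_def by blast+

lemma closed_conditions_shrink:
  assumes N: "N \<in> closed_conditions n" and "(k, v) \<in> N" "k \<le> b" "b \<le> v"
  shows "(k, b) \<in> N"
  using assms(4,3,2)
proof (induction rule: inc_induct)
  case (step b)
  then have "(k, Suc b) \<in> N" by simp
  then show ?case
    using closed_conditionsD(1)[OF N, of k "Suc b"] closed_conditionsD(3)[OF N, of k "Suc b"] step by simp
qed

lemma closed_conditions_shrink_right: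
  assumes N: "N \<in> closed_conditions n" and "(k, v) \<in> N" "k < b" "b \<le> v"
  shows "(b, k) \<in> N"
  using closed_conditions_shrink[OF N assms(2) _ assms(4)] assms(3)
    closed_conditionsD(4)[OF N, of k b] closed_conditionsD(1)[OF N, of k b] by simp

section \<open>Duality for conditions\<close>

text \<open>For the transposed function the condition \<open>(n - k, n - 1 - v)\<close> is the
  negation of \<open>f k \<le> v\<close>; a condition and its negation are constant on the same
  classes.\<close>

definition swap_condition :: "nat \<Rightarrow> nat \<times> nat \<Rightarrow> nat \<times> nat" where
  "swap_condition n = (\<lambda>(k, v). (n - k, n - 1 - v))"

lemma swap_condition_swap: "c \<in> conditions n \<Longrightarrow> swap_condition n (swap_condition n c) = c"
  by (auto simp: swap_condition_def conditions_def)

lemma swap_condition_conditions: "c \<in> conditions n \<Longrightarrow> swap_condition n c \<in> conditions n"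
  by (auto simp: swap_condition_def conditions_def)

lemma swap_condition_image_iff:
  assumes "N \<subseteq> conditions n" "0 < k" "k < n" "v < n"
  shows "(k, v) \<in> swap_condition n ` N \<longleftrightarrow> (n - k, n - 1 - v) \<in> N"
proof -
  have "(k, v) \<in> conditions n" using assms by (simp add: conditions_def)
  then have "(k, v) \<in> swap_condition n ` N \<longleftrightarrow> swap_condition n (k, v) \<in> N"
    using assms(1) swap_condition_swap by (metis (no_types, lifting) image_iff subsetD)
  then show ?thesis by (simp add: swap_condition_def)
qed

lemma reflect_le_iff:
  assumes f: "f \<in> arrow_funs n" and "0 < k" "k < n" "v < n"
  shows "reflect n f k \<le> n - 1 - v \<longleftrightarrow> \<not> f (n - k) \<le> v"
  using assms arrow_funsD(2)[OF f, of "n - k"] by (auto simp: reflect_def)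

text \<open>Transposition maps \<open>[i, j]\<close> to \<open>[n - j, n - i]\<close> and
  interchanges its two conditions, so the two conclusions of the second closure rule trade
  places.\<close>

lemma closed_conditions_swap:
  assumes N: "N \<in> closed_conditions n"
  shows "swap_condition n ` N \<in> closed_conditions n"
proof -
  have sub: "N \<subseteq> conditions n" using N by (simp add: closed_conditions_def)
  note iff = swap_condition_image_iff[OF sub]
  note D = closed_conditionsD[OF N]
  have 1: "(k, k) \<in> swap_condition n ` N \<longleftrightarrow> (k, k - 1) \<in> swap_condition n ` N" if "0 < k" "k < n" for k
    using that D(2)[of "n - k"] by (simp add: iff)
  have 2: "(i, j - 1) \<in> swap_condition n ` N \<and> (j, i) \<in> swap_condition n ` N"
    if "0 < i" "i < j" "j < n" "(i, j) \<in> swap_condition n ` N \<or> (j, i - 1) \<in> swap_condition n ` N" for i j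
  proof -
    have iffs: "(i, j) \<in> swap_condition n ` N \<longleftrightarrow> (n - i, n - j - 1) \<in> N"
      "(j, i - 1) \<in> swap_condition n ` N \<longleftrightarrow> (n - j, n - i) \<in> N"
      "(i, j - 1) \<in> swap_condition n ` N \<longleftrightarrow> (n - i, n - j) \<in> N"
      "(j, i) \<in> swap_condition n ` N \<longleftrightarrow> (n - j, n - i - 1) \<in> N"
      using iff[of i j] iff[of j "i - 1"] iff[of i "j - 1"] iff[of j i] that by simp_all
    have "(n - j, n - i) \<in> N \<or> (n - i, n - j - 1) \<in> N"
      using that(4) iffs by blast
    then have "(n - j, n - i - 1) \<in> N \<and> (n - i, n - j) \<in> N"
      using D(3,4)[of "n - j" "n - i"] that by auto
    then show ?thesis using iffs by blast
  qed
  show ?thesis unfolding closed_conditions_def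
    using sub swap_condition_conditions 1 2 by blast
qed

lemma agreement_swap:
  assumes N: "N \<subseteq> conditions n" and f: "f \<in> arrow_funs n" and g: "g \<in> arrow_funs n"
  shows "(reflect n f, reflect n g) \<in> agreement n (swap_condition n ` N) \<longleftrightarrow> (f, g) \<in> agreement n N"
proof -
  have "(reflect n f (n - k) \<le> n - 1 - v \<longleftrightarrow> reflect n g (n - k) \<le> n - 1 - v) \<longleftrightarrow> (f k \<le> v \<longleftrightarrow> g k \<le> v)"
    if "(k, v) \<in> N" for k v
  proof -
    have "0 < k" "k < n" "v < n" using that N by (auto simp: conditions_def)
    then show ?thesis
      using reflect_le_iff[OF f, of "n - k" v] reflect_le_iff[OF g, of "n - k" v] by simp
  qed
  moreover have "(reflect n f, reflect n g) \<in> agreement n (swap_condition n ` N) \<longleftrightarrow>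
      (\<forall>(k, v)\<in>N. reflect n f (n - k) \<le> n - 1 - v \<longleftrightarrow> reflect n g (n - k) \<le> n - 1 - v)"
    using reflect_arrow_funs[OF f] reflect_arrow_funs[OF g]
    by (simp add: agreement_def swap_condition_def case_prod_unfold)
  ultimately show ?thesis using f g unfolding agreement_def by blast
qed

section \<open>Closed sets of conditions define congruences\<close>

text \<open>Since \<open>agreement\<close> is symmetric, one implication suffices. A witness
  \<open>b\<close> bounding the join for \<open>f\<close> serves for \<open>f'\<close> as well,
  because closure passes from \<open>(k, v)\<close> to \<open>(k, b)\<close> and, if
  \<open>b > k\<close>, to \<open>(b, k)\<close>.\<close>

lemma agreement_join1:
  assumes N: "N \<in> closed_conditions n" and ff': "(f, f') \<in> agreement n N" and g: "g \<in> arrow_funs n"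
    and kv: "(k, v) \<in> N" and le: "arrow_join n f g k \<le> v"
  shows "arrow_join n f' g k \<le> v"
proof -
  have f: "f \<in> arrow_funs n" and f': "f' \<in> arrow_funs n"
    and iff: "\<And>k v. (k, v) \<in> N \<Longrightarrow> f k \<le> v \<longleftrightarrow> f' k \<le> v"
    using ff' by (auto simp: agreement_def)
  have k: "0 < k" "k < n" "v < n" using closed_conditionsD(1)[OF N kv] by auto
  show ?thesis
  proof (cases "v < k")
    case True
    then show ?thesis
      using le iff[OF kv] arrow_join_le_iff_inner[OF f g k(1,2)] arrow_join_le_iff_inner[OF f' g k(1,2)]
      by blast
  next
    case False
    then obtain b where b: "k \<le> b" "b \<le> v" "f k \<le> b" "g k \<le> b" "f b < k" "g b < k"
      using le arrow_join_le_iff_outer[OF f g k(1) _ k(3)] by force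
    have kb: "(k, b) \<in> N" using closed_conditions_shrink[OF N kv b(1,2)] .
    then have f'k: "f' k \<le> b" using iff b(3) by blast
    have "f' b < k"
    proof (cases "b = k")
      case True
      then show ?thesis using f'k arrow_funsD(3)[OF f' k(1,2)] by simp
    next
      case False
      then have "(b, k) \<in> N" using closed_conditions_shrink_right[OF N kv] b by simp
      then have "f' b \<le> k" using iff[of b k] b(5) by simp
      \<comment> \<open>If \<open>f' b = k\<close>, the support clause at \<open>b\<close> would
        give \<open>f' k > b\<close>, against \<open>f' k \<le> b\<close>.\<close>
      moreover have "f' b \<noteq> k"
        using arrow_funsD(4)[OF f', of b] f'k False b k by auto
      ultimately show ?thesis by simp
    qed
    then show ?thesis using arrow_join_le_iff_outer[OF f' g k(1) _ k(3)] b f'k False by auto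
  qed
qed

lemma agreement_join:
  assumes N: "N \<in> closed_conditions n"
    and "(f, f') \<in> agreement n N" "(g, g') \<in> agreement n N"
  shows "(arrow_join n f g, arrow_join n f' g') \<in> agreement n N"
proof -
  have m: "f \<in> arrow_funs n" "f' \<in> arrow_funs n" "g \<in> arrow_funs n" "g' \<in> arrow_funs n"
    and sym: "(f', f) \<in> agreement n N" "(g', g) \<in> agreement n N"
    using assms by (auto simp: agreement_def)
  have "arrow_join n f g k \<le> v \<longleftrightarrow> arrow_join n f' g' k \<le> v" if "(k, v) \<in> N" for k v
  proof -
    have "arrow_join n f g k \<le> v \<longleftrightarrow> arrow_join n f' g k \<le> v"
      using agreement_join1[OF N assms(2) m(3) that] agreement_join1[OF N sym(1) m(3) that] by blast
    also have "\<dots> \<longleftrightarrow> arrow_join n f' g' k \<le> v"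
      using agreement_join1[OF N assms(3) m(2) that] agreement_join1[OF N sym(2) m(2) that]
      unfolding arrow_join_commute[of n f'] by blast
    finally show ?thesis .
  qed
  then show ?thesis using m arrow_join_closed unfolding agreement_def by blast
qed

text \<open>Compatibility with meets is compatibility with joins for the swapped set, after
  transposition.\<close>

lemma agreement_congs:
  assumes N: "N \<in> closed_conditions n"
  shows "agreement n N \<in> arrow_congs n"
proof -
  have sub: "N \<subseteq> conditions n" using N by (simp add: closed_conditions_def)
  have "equiv (arrow_funs n) (agreement n N)"
    by (rule equivI) (auto simp: agreement_def refl_on_def sym_def trans_def)
  moreover have "(arrow_meet n f g, arrow_meet n f' g') \<in> agreement n N"
    if "(f, f') \<in> agreement n N" "(g, g') \<in> agreement n N" for f f' g g'
  proof -
    have m: "f \<in> arrow_funs n" "f' \<in> arrow_funs n" "g \<in> arrow_funs n" "g' \<in> arrow_funs n"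
      using that by (auto simp: agreement_def)
    have "(reflect n (arrow_meet n f g), reflect n (arrow_meet n f' g')) \<in> agreement n (swap_condition n ` N)"
      using agreement_join[OF closed_conditions_swap[OF N]] that m
      by (simp add: agreement_swap[OF sub] reflect_meet)
    then show ?thesis by (simp add: agreement_swap[OF sub] m arrow_meet_closed)
  qed
  ultimately show ?thesis using agreement_join[OF N] by (simp add: arrow_congs_def)
qed

text \<open>Pullback along transposition, which exchanges meets and joins; it lets half of the cases
  below follow from the other half.\<close>

definition reflect_rel :: "nat \<Rightarrow> ((nat \<Rightarrow> nat) \<times> (nat \<Rightarrow> nat)) set \<Rightarrow> ((nat \<Rightarrow> nat) \<times> (nat \<Rightarrow> nat)) set" where
  "reflect_rel n R = {(f, g). f \<in> arrow_funs n \<and> g \<in> arrow_funs n \<and> (reflect n f, reflect n g) \<in> R}"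

lemma reflect_rel_congs:
  assumes R: "R \<in> arrow_congs n"
  shows "reflect_rel n R \<in> arrow_congs n"
proof -
  note D = arrow_congsD[OF R]
  have "equiv (arrow_funs n) (reflect_rel n R)"
    unfolding equiv_def refl_on_def sym_def trans_def
  proof (intro conjI ballI allI impI subrelI)
    show "(f, h) \<in> reflect_rel n R" if "(f, g) \<in> reflect_rel n R" "(g, h) \<in> reflect_rel n R" for f g h
      using that D(5)[of "reflect n f" "reflect n g" "reflect n h"] by (simp add: reflect_rel_def)
  qed (auto simp: reflect_rel_def D(3,4) reflect_arrow_funs)
  moreover have "(arrow_meet n f g, arrow_meet n f' g') \<in> reflect_rel n R \<and>
      (arrow_join n f g, arrow_join n f' g') \<in> reflect_rel n R"
    if "(f, f') \<in> reflect_rel n R" "(g, g') \<in> reflect_rel n R" for f f' g g'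
    using that D(6,7)[of "reflect n f" "reflect n f'" "reflect n g" "reflect n g'"]
    by (simp add: reflect_rel_def reflect_join reflect_meet arrow_join_closed arrow_meet_closed)
  ultimately show ?thesis
    unfolding arrow_congs_def by blast
qed

lemma respected_reflect:
  assumes R: "R \<in> arrow_congs n"
  shows "respected n (reflect_rel n R) = swap_condition n ` respected n R"
proof -
  have 1: "swap_condition n c \<in> respected n (reflect_rel n R)"
    if R: "R \<in> arrow_congs n" and c: "c \<in> respected n R" for R c
  proof -
    obtain k v where c_def: "c = (k, v)" by fastforce
    have kv: "0 < k" "k < n" "v < n" using c by (auto simp: respected_def conditions_def c_def)
    have "f (n - k) \<le> n - 1 - v \<longleftrightarrow> g (n - k) \<le> n - 1 - v" if fg: "(f, g) \<in> reflect_rel n R" for f g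
    proof -
      have f: "f \<in> arrow_funs n" "g \<in> arrow_funs n" and r: "(reflect n f, reflect n g) \<in> R"
        using fg by (auto simp: reflect_rel_def)
      have "reflect n f k \<le> v \<longleftrightarrow> reflect n g k \<le> v" using c r by (auto simp: respected_def c_def)
      then show ?thesis
        using reflect_le_iff[OF f(1), of k "n - 1 - v"] reflect_le_iff[OF f(2), of k "n - 1 - v"] kv by auto
    qed
    then show ?thesis
      using swap_condition_conditions[of c n] c by (auto simp: respected_def c_def swap_condition_def)
  qed
  \<comment> \<open>The inclusion just shown, applied to the pulled-back relation, yields the
    reverse inclusion, since pulling back twice changes nothing.\<close>
  have involution: "reflect_rel n (reflect_rel n R) = R"
    using arrow_congsD(1,2)[OF R] reflect_arrow_funs reflect_reflect by (auto simp: reflect_rel_def)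
  show ?thesis
  proof (intro equalityI subsetI)
    fix c assume c: "c \<in> respected n (reflect_rel n R)"
    then have "swap_condition n c \<in> respected n R"
      using 1[OF reflect_rel_congs[OF R]] involution by metis
    moreover have "c \<in> conditions n" using c by (auto simp: respected_def)
    ultimately show "c \<in> swap_condition n ` respected n R"
      using swap_condition_swap by (metis image_eqI)
  qed (use 1[OF R] in blast)
qed

section \<open>The conditions respected by a congruence form a closed set\<close>

text \<open>For \<open>v < k < n\<close> this is the largest arrow function with value at most
  \<open>v\<close> at \<open>k\<close>.\<close>

definition point_fun :: "nat \<Rightarrow> nat \<Rightarrow> nat \<Rightarrow> nat \<Rightarrow> nat" where
  "point_fun n k v j = (if \<not> (0 < j \<and> j < n) then 0 else if j = k then v else n)"

lemma point_fun_closed: "v < k \<Longrightarrow> k < n \<Longrightarrow> point_fun n k v \<in> arrow_funs n"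
  by (rule arrow_funsI) (auto simp: point_fun_def split: if_splits)

lemma le_point_fun:
  assumes "f \<in> arrow_funs n" "f k \<le> v"
  shows "f \<le> point_fun n k v"
  using assms arrow_funsD(2)[OF assms(1)] by (intro arrow_fun_le) (auto simp: point_fun_def)

text \<open>A normal form for a violated condition \<open>(i, w)\<close>: instead of an arbitrary
  pair, the fixed function \<open>s\<close> is related to one above it that jumps to
  \<open>n\<close> at \<open>i\<close>. The order of the cases gives \<open>s i = i - 1\<close> when
  \<open>w = i\<close>, since the value \<open>i\<close> is forbidden there.\<close>

lemma respected_edge:
  assumes R: "R \<in> arrow_congs n" and "(i, w) \<in> conditions n" "i \<le> w" "(i, w) \<notin> respected n R"
  defines "s \<equiv> \<lambda>k. if \<not> (0 < k \<and> k < n) then 0 else if k = w then i - 1 else if k = i then w else n"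
  obtains z where "(s, z) \<in> R" "s \<le> z" "z i = n"
proof -
  note D = arrow_congsD[OF R]
  have i: "0 < i" "i < n" "w < n" using assms by (auto simp: conditions_def)
  obtain f g where fg: "(f, g) \<in> R" "f i \<le> w" "w < g i"
  proof -
    obtain f g where "(f, g) \<in> R" "(f i \<le> w) \<noteq> (g i \<le> w)"
      using assms by (auto simp: respected_def)
    then show ?thesis using that D(4) by (meson not_le)
  qed
  have m: "f \<in> arrow_funs n" "g \<in> arrow_funs n" using D fg by blast+
  \<comment> \<open>The least arrow function violating the condition; meeting the pair
    \<open>f\<close>, \<open>g\<close> with it gives a related pair whose second member is
    \<open>q\<close> itself.\<close>
  define q where "q = (\<lambda>k. if k = i then w + 1 else 0)"
  have q: "q \<in> arrow_funs n"
    using i \<open>i \<le> w\<close> by (intro arrow_funsI) (auto simp: q_def split: if_splits)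
  have s: "s \<in> arrow_funs n"
    using i \<open>i \<le> w\<close> by (intro arrow_funsI) (auto simp: s_def split: if_splits)
  define y where "y = arrow_meet n f q"
  have y: "y \<in> arrow_funs n" unfolding y_def using m q arrow_meet_closed by blast
  have "arrow_meet n q g = q"
    using m q fg by (intro arrow_meet_absorb) (auto simp: le_fun_def q_def)
  then have "arrow_meet n g q = q" by (simp add: arrow_meet_def arrow_join_commute)
  then have yq: "(y, q) \<in> R" using D(6)[OF fg(1) D(3)[OF q]] by (simp add: y_def)
  have "y \<le> s"
  proof (rule arrow_fun_le[OF y])
    fix k assume k: "0 < k" "k < n"
    have "y k \<le> q k" "y k \<le> f k" using arrow_meet_lower[OF m(1) q] by (auto simp: y_def le_fun_def)
    then show "y k \<le> s k"
      using k fg(2) arrow_funsD(3)[OF y k] by (auto simp: s_def q_def split: if_splits)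
  qed
  define z where "z = arrow_join n s q"
  have "arrow_join n s y = s" using arrow_join_absorb s y \<open>y \<le> s\<close> by blast
  then have "(s, z) \<in> R" using D(7)[OF D(3)[OF s] yq] by (simp add: z_def)
  moreover have "s \<le> z" unfolding z_def by (rule arrow_join_upper[OF s q])
  \<comment> \<open>A value \<open>z i\<close> strictly between \<open>w\<close> and
    \<open>n\<close> would force \<open>z\<close> below \<open>i\<close> at the position
    \<open>z i\<close>, where already \<open>s\<close> is \<open>n\<close>.\<close>
  moreover have "z i = n"
  proof (rule ccontr)
    assume ne: "z i \<noteq> n"
    have z: "z \<in> arrow_funs n" unfolding z_def by (rule arrow_join_closed[OF s q])
    have "q i \<le> z i" using arrow_join_upper[OF s q] by (auto simp: z_def le_fun_def)
    then have gt: "w < z i" by (simp add: q_def)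
    then have "z (z i) < i" using ne arrow_funsD(2,5)[OF z, of i] \<open>i \<le> w\<close> by auto
    moreover have "s (z i) = n"
      using gt ne arrow_funsD(2)[OF z, of i] \<open>i \<le> w\<close> by (auto simp: s_def)
    ultimately show False using \<open>s \<le> z\<close> i by (metis le_funD leD less_trans)
  qed
  ultimately show ?thesis using that by blast
qed

text \<open>By contraposition: if \<open>(i, j - 1)\<close> is violated, the pair \<open>s\<close>,
  \<open>z\<close> for \<open>w = j - 1\<close> violates \<open>(i, j)\<close> at once, and its
  meets with the largest function of value at most \<open>i\<close> at \<open>j\<close> violate
  \<open>(j, i - 1)\<close>.\<close>

lemma respected_closed1:
  assumes R: "R \<in> arrow_congs n" and ij: "0 < i" "i < j" "j < n"
    and "(i, j) \<in> respected n R \<or> (j, i - 1) \<in> respected n R"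
  shows "(i, j - 1) \<in> respected n R"
proof (rule ccontr)
  assume neg: "(i, j - 1) \<notin> respected n R"
  note D = arrow_congsD[OF R]
  define w where "w = j - 1"
  have w: "i \<le> w" "w < j" "(i, w) \<in> conditions n" using ij by (auto simp: w_def conditions_def)
  define s where "s = (\<lambda>k. if \<not> (0 < k \<and> k < n) then 0 else if k = w then i - 1 else if k = i then w else n)"
  obtain z where z: "(s, z) \<in> R" "s \<le> z" "z i = n"
    using respected_edge[OF R w(3,1)] neg unfolding w_def[symmetric] s_def by blast
  have si: "s i \<le> w" using ij w by (auto simp: s_def)
  have "(i, j) \<notin> respected n R"
    using z si w ij by (auto simp: respected_def intro!: bexI[OF _ z(1)])
  moreover have "(j, i - 1) \<notin> respected n R"
  proof
    assume A: "(j, i - 1) \<in> respected n R"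
    define p where "p = point_fun n j i"
    have p: "p \<in> arrow_funs n" using ij point_fun_closed by (simp add: p_def)
    have m: "s \<in> arrow_funs n" "z \<in> arrow_funs n" using D z by blast+
    define s' where "s' = arrow_meet n s p"
    define z' where "z' = arrow_meet n z p"
    have R': "(s', z') \<in> R" using D(6)[OF z(1) D(3)[OF p]] by (simp add: s'_def z'_def)
    have s': "s' \<in> arrow_funs n" "s' \<le> s" "s' \<le> p"
      using m p arrow_meet_closed arrow_meet_lower by (auto simp: s'_def)
    have "s' j \<le> i" using s'(3) ij by (auto simp: p_def point_fun_def dest!: le_funD[of _ _ j])
    \<comment> \<open>Otherwise the support clause gives \<open>s' i > j\<close>, while
      \<open>s' i \<le> s i < j\<close>.\<close>
    moreover have "s' j \<noteq> i"
      using arrow_funsD(4)[OF s'(1) ij(3)] ij le_funD[OF s'(2), of i] si w by auto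
    ultimately have "s' j \<le> i - 1" by simp
    then have "z' j \<le> i - 1" using A R' by (auto simp: respected_def)
    moreover have "i \<le> z' j"
    proof -
      \<comment> \<open>A common lower bound of \<open>z\<close> and \<open>p\<close> with value
        \<open>i\<close> at \<open>j\<close>, allowed because its value at \<open>i\<close> is
        \<open>n\<close>. Testing \<open>k = i\<close> first covers the case
        \<open>w = i\<close>.\<close>
      define t where "t = (\<lambda>k. if \<not> (0 < k \<and> k < n) then 0 else if k = i then n else if k = w then i - 1
        else if k = j then i else n)"
      have t: "t \<in> arrow_funs n"
        using ij w by (intro arrow_funsI) (auto simp: t_def split: if_splits)
      have "t \<le> z"
      proof (rule arrow_fun_le[OF t])
        fix k assume "0 < k" "k < n"
        then show "t k \<le> z k"
          using le_funD[OF z(2), of k] z(3) ij by (auto simp: t_def s_def split: if_splits)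
      qed
      moreover have "t \<le> p"
        using ij w by (intro arrow_fun_le[OF t]) (auto simp: t_def p_def point_fun_def)
      ultimately have "t \<le> z'" using arrow_meet_greatest[OF m(2) p t] by (simp add: z'_def)
      then show ?thesis using le_funD[of t z' j] ij w by (auto simp: t_def)
    qed
    ultimately show False using ij by simp
  qed
  ultimately show False using assms by blast
qed

text \<open>The rule yielding \<open>(j, i)\<close> is the one yielding \<open>(i, j - 1)\<close>
  for the transposed congruence.\<close>

lemma respected_closed:
  assumes R: "R \<in> arrow_congs n"
  shows "respected n R \<in> closed_conditions n"
proof -
  have sub: "respected n R \<subseteq> conditions n" by (auto simp: respected_def)
  note iff = swap_condition_image_iff[OF sub]
  have 1: "(k, k) \<in> respected n R \<longleftrightarrow> (k, k - 1) \<in> respected n R" if k: "0 < k" "k < n" for k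
  proof -
    have "f k \<le> k \<longleftrightarrow> f k \<le> k - 1" if "f \<in> arrow_funs n" for f
      using arrow_funsD(3)[OF that k] by linarith
    then show ?thesis
      using arrow_congsD(1,2)[OF R] k by (fastforce simp: respected_def conditions_def)
  qed
  have 2: "(j, i) \<in> respected n R"
    if ij: "0 < i" "i < j" "j < n" and or: "(i, j) \<in> respected n R \<or> (j, i - 1) \<in> respected n R" for i j
  proof -
    have "(n - j, n - i) \<in> respected n (reflect_rel n R) \<or> (n - i, n - j - 1) \<in> respected n (reflect_rel n R)"
      unfolding respected_reflect[OF R] using or ij iff[of "n - j" "n - i"] iff[of "n - i" "n - j - 1"] by auto
    then have "(n - j, n - i - 1) \<in> respected n (reflect_rel n R)"
      using respected_closed1[OF reflect_rel_congs[OF R], of "n - j" "n - i"] ij by auto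
    then show ?thesis
      unfolding respected_reflect[OF R] using ij iff[of "n - j" "n - i - 1"] by auto
  qed
  show ?thesis unfolding closed_conditions_def
    using sub 1 2 respected_closed1[OF R] by blast
qed

section \<open>Congruences and closed sets of conditions determine each other\<close>

text \<open>A condition outside \<open>N\<close> must be violated by a related pair. For
  \<open>v < k\<close> two functions differing only at \<open>k\<close> do this; the case
  \<open>v \<ge> k\<close> is its transpose.\<close>

lemma respected_agreement:
  assumes N: "N \<in> closed_conditions n"
  shows "respected n (agreement n N) = N"
proof
  have sub: "N \<subseteq> conditions n" using N by (simp add: closed_conditions_def)
  then show "N \<subseteq> respected n (agreement n N)"
    by (auto simp: respected_def agreement_def)
  have inner: "(k, v) \<in> N"
    if N: "N \<in> closed_conditions n" and kv: "(k, v) \<in> respected n (agreement n N)" "v < k" for N k v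
  proof (rule ccontr)
    assume neg: "(k, v) \<notin> N"
    have k: "0 < k" "k < n" using kv by (auto simp: respected_def conditions_def)
    define f where "f = point_fun n k v"
    \<comment> \<open>The next larger value at \<open>k\<close>, with \<open>n\<close> elsewhere.
      After \<open>v = k - 1\<close> this is \<open>n\<close>: the value \<open>k\<close> is
      forbidden, and a value strictly between \<open>k\<close> and \<open>n\<close> would need a
      small value at another position.\<close>
    define g where "g = (if v + 1 = k then \<lambda>j. if 0 < j \<and> j < n then n else 0 else point_fun n k (v + 1))"
    have "(\<lambda>j. if 0 < j \<and> j < n then n else 0) \<in> arrow_funs n"
      by (rule arrow_funsI) (auto split: if_splits)
    then have m: "f \<in> arrow_funs n" "g \<in> arrow_funs n"
      using point_fun_closed kv(2) k by (auto simp: f_def g_def)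
    have "f j \<le> u \<longleftrightarrow> g j \<le> u" if ju: "(j, u) \<in> N" for j u
    proof (cases "j = k")
      case True
      have "u \<noteq> v" using neg ju True by blast
      \<comment> \<open>An element \<open>(k, u)\<close> of \<open>N\<close> with
        \<open>u \<ge> k\<close> would shrink to \<open>(k, k)\<close> and so bring in
        \<open>(k, k - 1)\<close>, which is \<open>(k, v)\<close>.\<close>
      moreover have "v + 1 = k \<Longrightarrow> u < k"
        using closed_conditions_shrink[OF N, of k u k] closed_conditionsD(2)[OF N k] ju True neg by force
      ultimately show ?thesis
        using closed_conditionsD(1)[OF N ju] True by (auto simp: f_def g_def point_fun_def)
    qed (use closed_conditionsD(1)[OF N ju] in \<open>auto simp: f_def g_def point_fun_def\<close>)
    then have "(f, g) \<in> agreement n N" using m by (auto simp: agreement_def)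
    then have "f k \<le> v \<longleftrightarrow> g k \<le> v" using kv by (auto simp: respected_def)
    then show False using k kv(2) by (auto simp: f_def g_def point_fun_def split: if_splits)
  qed
  show "respected n (agreement n N) \<subseteq> N"
  proof safe
    fix k v assume kv: "(k, v) \<in> respected n (agreement n N)"
    then have k: "0 < k" "k < n" "v < n" by (auto simp: respected_def conditions_def)
    show "(k, v) \<in> N"
    proof (cases "v < k")
      case True
      then show ?thesis using inner[OF N kv] by simp
    next
      case False
      have "(f, g) \<in> reflect_rel n (agreement n N) \<longleftrightarrow> (f, g) \<in> agreement n (swap_condition n ` N)" for f g
      proof (cases "f \<in> arrow_funs n \<and> g \<in> arrow_funs n")
        case True
        then show ?thesis
          using agreement_swap[OF sub, of "reflect n f" "reflect n g"]
          by (simp add: reflect_rel_def reflect_arrow_funs reflect_reflect)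
      qed (auto simp: reflect_rel_def agreement_def)
      then have "reflect_rel n (agreement n N) = agreement n (swap_condition n ` N)"
        by (intro equalityI subrelI) blast+
      then have "(n - k, n - 1 - v) \<in> respected n (agreement n (swap_condition n ` N))"
        using respected_reflect[OF agreement_congs[OF N]] kv by (force simp: swap_condition_def)
      then have "(n - k, n - 1 - v) \<in> swap_condition n ` N"
        using inner[OF closed_conditions_swap[OF N]] False k by simp
      then show ?thesis using swap_condition_image_iff[OF sub, of "n - k" "n - 1 - v"] k by simp
    qed
  qed
qed

text \<open>A step of descent from \<open>x\<close> towards \<open>y\<close>: a condition at
  \<open>k\<close> distinguishing them is violated by some pair in \<open>R\<close>; joining that
  pair with \<open>p\<close> and then meeting with \<open>x\<close> moves the violation to
  \<open>x\<close>.\<close>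

lemma respected_step:
  assumes R: "R \<in> arrow_congs n" and xy: "(x, y) \<in> agreement n (respected n R)" "y \<le> x"
    and k: "y k < k" "y k < x k"
  obtains z where "(x, z) \<in> R" "y \<le> z" "z \<le> x" "z \<noteq> x"
proof -
  note D = arrow_congsD[OF R]
  have m: "x \<in> arrow_funs n" "y \<in> arrow_funs n" using xy by (auto simp: agreement_def)
  have kn: "0 < k" "k < n" using k(2) arrow_funsD(1)[OF m(1), of k] by (metis not_less_zero)+
  \<comment> \<open>A threshold separating \<open>y k\<close> from \<open>x k\<close>, capped at
    \<open>k - 1\<close> so that \<open>point_fun n k v\<close> is an arrow function.\<close>
  define v where "v = min (x k - 1) (k - 1)"
  have v: "y k \<le> v" "v < x k" "v < k" using k by (auto simp: v_def)
  have "(k, v) \<notin> respected n R"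
    using xy v by (auto simp: agreement_def)
  then obtain f g where fg: "(f, g) \<in> R" "f k \<le> v" "v < g k"
  proof -
    obtain f g where "(f, g) \<in> R" "(f k \<le> v) \<noteq> (g k \<le> v)"
      using \<open>(k, v) \<notin> respected n R\<close> v kn by (auto simp: respected_def conditions_def)
    then show ?thesis using that D(4) by (meson not_le)
  qed
  define p where "p = point_fun n k v"
  define h where "h = arrow_join n p g"
  have p: "p \<in> arrow_funs n" using v kn point_fun_closed by (simp add: p_def)
  have fm: "f \<in> arrow_funs n" "g \<in> arrow_funs n" using D fg by blast+
  have "arrow_join n p f = p"
    using arrow_join_absorb[OF p fm(1)] le_point_fun[OF fm(1) fg(2)] by (simp add: p_def)
  then have ph: "(p, h) \<in> R" using D(7)[OF D(3)[OF p] fg(1)] by (simp add: h_def)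
  have hm: "h \<in> arrow_funs n" unfolding h_def by (rule arrow_join_closed[OF p fm(2)])
  have hu: "p j \<le> h j" "g j \<le> h j" for j
    using arrow_join_upper[OF p fm(2)] by (auto simp: h_def le_fun_def)
  \<comment> \<open>Away from \<open>k\<close> already \<open>p\<close> is \<open>n\<close>. At
    \<open>k\<close>, \<open>h\<close> exceeds \<open>v\<close>; if \<open>x k\<close> is not below
    \<open>k\<close>, then \<open>h k > k\<close>, and a value below \<open>n\<close> is excluded
    because \<open>h\<close> is \<open>n\<close> at every other position.\<close>
  have "x \<le> h"
  proof (rule arrow_fun_le[OF m(1)])
    fix j assume j: "0 < j" "j < n"
    show "x j \<le> h j"
    proof (cases "j = k")
      case False
      then show ?thesis
        using hu(1)[of j] j arrow_funsD(2)[OF m(1), of j] by (simp add: p_def point_fun_def)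
    next
      case True
      show ?thesis
      proof (cases "x k < k")
        case True
        then show ?thesis using \<open>j = k\<close> hu(2)[of k] fg(3) by (simp add: v_def)
      next
        case False
        then have "k < h k"
          using hu(2)[of k] fg(3) arrow_funsD(3)[OF hm kn] by (simp add: v_def)
        moreover have "h k < n \<Longrightarrow> h (h k) < k" using arrow_funsD(5)[OF hm \<open>k < h k\<close>] .
        moreover have "h k < n \<Longrightarrow> n \<le> h (h k)"
          using hu(1)[of "h k"] \<open>k < h k\<close> by (simp add: p_def point_fun_def)
        ultimately have "n \<le> h k" using kn by fastforce
        then show ?thesis using arrow_funsD(2)[OF m(1), of k] \<open>j = k\<close> by simp
      qed
    qed
  qed
  then have "arrow_meet n x h = x" using arrow_meet_absorb m hm by blast
  then have "(x, arrow_meet n x p) \<in> R"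
    using D(6)[OF D(3)[OF m(1)] D(4)[OF ph]] by simp
  moreover have "y \<le> arrow_meet n x p"
    using arrow_meet_greatest[OF m(1) p m(2) xy(2)] le_point_fun[OF m(2) v(1)] by (simp add: p_def)
  moreover have "arrow_meet n x p \<noteq> x"
    using le_funD[OF arrow_meet_lower(2)[OF m(1) p], of k] v kn by (auto simp: p_def point_fun_def)
  ultimately show ?thesis using that arrow_meet_lower(1)[OF m(1) p] by blast
qed

text \<open>Induction on the size of the interval from \<open>y\<close> to \<open>x\<close>. At a
  position \<open>k\<close> where they differ, \<open>y k < k\<close> allows a step down from
  \<open>x\<close>; otherwise \<open>x k > k\<close>, and the transposed step goes up from
  \<open>y\<close>.\<close>

lemma agreement_respected_le:
  assumes R: "R \<in> arrow_congs n" and "(x, y) \<in> agreement n (respected n R)" "y \<le> x"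
  shows "(x, y) \<in> R"
  using assms(2,3)
proof (induction "card {z \<in> arrow_funs n. y \<le> z \<and> z \<le> x}" arbitrary: x y rule: less_induct)
  case less
  note D = arrow_congsD[OF R]
  have m: "x \<in> arrow_funs n" "y \<in> arrow_funs n" using less.prems by (auto simp: agreement_def)
  have fin: "finite {z \<in> arrow_funs n. y \<le> z \<and> z \<le> x}" using finite_arrow_funs by simp
  have subR: "(u, w) \<in> R \<Longrightarrow> (u, w) \<in> agreement n (respected n R)" for u w
    using D(1,2) by (auto simp: agreement_def respected_def)
  have A: "(u, w) \<in> agreement n (respected n R) \<Longrightarrow> (w, u) \<in> agreement n (respected n R)"
    "(u, w) \<in> agreement n (respected n R) \<Longrightarrow> (w, t) \<in> agreement n (respected n R) \<Longrightarrow> (u, t) \<in> agreement n (respected n R)" for u w t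
    by (auto simp: agreement_def)
  show ?case
  proof (cases "x = y")
    case True
    then show ?thesis using D(3) m by simp
  next
    case False
    then obtain k where k: "y k < x k"
      using less.prems(2) by (metis ext le_funD le_neq_implies_less)
    show ?thesis
    proof (cases "y k < k")
      case True
      obtain z where z: "(x, z) \<in> R" "y \<le> z" "z \<le> x" "z \<noteq> x"
        using respected_step[OF R less.prems True k] by blast
      have "{w \<in> arrow_funs n. y \<le> w \<and> w \<le> z} \<subset> {w \<in> arrow_funs n. y \<le> w \<and> w \<le> x}"
        using z m less.prems(2) by (auto intro: order_trans dest: antisym)
      then have "(z, y) \<in> R"
        using less.hyps[OF psubset_card_mono[OF fin]] A(2)[OF A(1)[OF subR[OF z(1)]] less.prems(1)] z(2) by blast
      then show ?thesis using D(5) z(1) by blast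
    next
      case False
      let ?R = "reflect_rel n R"
      have kn: "0 < k" "k < n" using k arrow_funsD(1)[OF m(1), of k] by (metis not_less_zero)+
      have xk: "k < x k" using False k by simp
      have "(reflect n y, reflect n x) \<in> agreement n (respected n ?R)"
        using agreement_swap[of "respected n R" n y x] m A(1)[OF less.prems(1)]
        unfolding respected_reflect[OF R] by (auto simp: respected_def)
      moreover have "reflect n x (n - k) < n - k" "reflect n x (n - k) < reflect n y (n - k)"
        using kn xk k arrow_funsD(2)[OF m(1), of k] by (auto simp: reflect_def)
      ultimately obtain z where z: "(reflect n y, z) \<in> ?R" "reflect n x \<le> z" "z \<le> reflect n y" "z \<noteq> reflect n y"
        using respected_step[OF reflect_rel_congs[OF R]] reflect_le[OF less.prems(2)] by blast
      define z' where "z' = reflect n z"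
      have zm: "z \<in> arrow_funs n" using z(1) by (auto simp: reflect_rel_def)
      have z': "z' \<in> arrow_funs n" "(y, z') \<in> R" "y \<le> z'" "z' \<le> x" "z' \<noteq> y"
        using z reflect_le[OF z(2), of n] reflect_le[OF z(3), of n] reflect_reflect[OF zm] m
        by (auto simp: z'_def reflect_rel_def reflect_reflect reflect_arrow_funs)
      have "{w \<in> arrow_funs n. z' \<le> w \<and> w \<le> x} \<subset> {w \<in> arrow_funs n. y \<le> w \<and> w \<le> x}"
        using z' m less.prems(2) by (auto intro: order_trans dest: antisym)
      then have "(x, z') \<in> R"
        using less.hyps[OF psubset_card_mono[OF fin]] A(2)[OF less.prems(1) subR[OF z'(2)]] z'(4) by blast
      then show ?thesis using D(4,5) z'(2) by blast
    qed
  qed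
qed

text \<open>Two agreeing elements both agree with their meet, because agreement is itself a
  congruence; this reduces the claim to comparable pairs.\<close>

lemma agreement_respected:
  assumes R: "R \<in> arrow_congs n"
  shows "agreement n (respected n R) = R"
proof (intro equalityI subrelI)
  note D = arrow_congsD[OF R]
  let ?A = "agreement n (respected n R)"
  fix x y assume xy: "(x, y) \<in> ?A"
  then have m: "x \<in> arrow_funs n" "y \<in> arrow_funs n" by (auto simp: agreement_def)
  note DA = arrow_congsD[OF agreement_congs[OF respected_closed[OF R]]]
  let ?m = "arrow_meet n x y"
  have "arrow_meet n x x = x" "arrow_meet n y y = y" using arrow_meet_absorb m by auto
  then have "(x, ?m) \<in> ?A" "(y, ?m) \<in> ?A"
    using DA(6)[OF DA(3)[OF m(1)] xy] DA(6)[OF DA(4)[OF xy] DA(3)[OF m(2)]] by auto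
  then show "(x, y) \<in> R"
    using agreement_respected_le[OF R] arrow_meet_lower[OF m] D(4,5) by blast
next
  show "(x, y) \<in> agreement n (respected n R)" if "(x, y) \<in> R" for x y
    using that arrow_congsD(1,2)[OF R] by (auto simp: agreement_def respected_def)
qed

lemma card_arrow_congs: "card (arrow_congs n) = card (closed_conditions n)"
proof (rule bij_betw_same_card[of "respected n"])
  show "bij_betw (respected n) (arrow_congs n) (closed_conditions n)"
    by (rule bij_betw_byWitness[where f' = "agreement n"])
      (auto simp: agreement_respected respected_agreement respected_closed agreement_congs)
qed

section \<open>Arrow functions encode small tableaux\<close>

text \<open>The clauses list the root, the up-arrows of the columns and the left-arrows of the rows.
  For the arrow that \<open>f\<close> does not record, \<open>min\<close> or \<open>max\<close>
  returns \<open>k\<close> and so gives the border cell.\<close>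

definition tab :: "nat \<Rightarrow> (nat \<Rightarrow> nat) \<Rightarrow> cell set" where
  "tab n f = {(i, j). (i = 1 \<and> j = n) \<or> (0 < j \<and> j < n \<and> i = min (f j) j + 1) \<or>
     (1 < i \<and> i \<le> n \<and> j = max (f (i - 1)) (i - 1))}"

text \<open>A left-arrow in column \<open>j\<close> off the border comes from some \<open>k\<close>
  with \<open>f k = j\<close>, and \<open>f (f k) < k\<close> puts it below the up-arrow of that
  column.\<close>

lemma tab_col_le:
  assumes f: "f \<in> arrow_funs n" and "(i, j) \<in> tab n f" "j < n"
  shows "min (f j) j + 1 \<le> i"
proof -
  have "i = min (f j) j + 1 \<or> (1 < i \<and> i \<le> n \<and> j = max (f (i - 1)) (i - 1))"
    using assms by (auto simp: tab_def)
  then show ?thesis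
  proof
    assume i: "1 < i \<and> i \<le> n \<and> j = max (f (i - 1)) (i - 1)"
    then show ?thesis
      using arrow_funsD(5)[OF f, of "i - 1"] assms(3) by (cases "i - 1 < f (i - 1)") auto
  qed simp
qed

lemma tab_row_le:
  assumes f: "f \<in> arrow_funs n" and "(i, j) \<in> tab n f" "1 < i"
  shows "j \<le> max (f (i - 1)) (i - 1)"
proof -
  have "(0 < j \<and> j < n \<and> i - 1 = min (f j) j) \<or> j = max (f (i - 1)) (i - 1)"
    using assms by (auto simp: tab_def)
  then show ?thesis
  proof
    assume i: "0 < j \<and> j < n \<and> i - 1 = min (f j) j"
    moreover have "0 < i - 1" using assms(3) by simp
    ultimately show ?thesis
      using arrow_funsD(4)[OF f, of j] by (cases "f j < j") auto
  qed simp
qed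

lemma tab_board:
  assumes f: "f \<in> arrow_funs n" and "1 \<le> n"
  shows "tab n f \<subseteq> board n"
  using assms(2) arrow_funsD(2)[OF f] by (auto simp: tab_def board_def max_def)

lemma tab_up_arrow_iff:
  assumes f: "f \<in> arrow_funs n"
  shows "up_arrow n (tab n f) (i, j) \<longleftrightarrow> 0 < j \<and> j < n \<and> i = min (f j) j + 1"
proof
  assume u: "up_arrow n (tab n f) (i, j)"
  then have T: "(i, j) \<in> tab n f" "(i, j) \<noteq> (1, n)"
    and na: "\<And>i'. (i', j) \<in> tab n f \<Longrightarrow> \<not> i' < i"
    by (auto simp: up_arrow_def above_def root_def)
  have j: "j \<le> n" "0 < j" "0 < i"
    using T arrow_funsD(2)[OF f] by (auto simp: tab_def)
  have "j \<noteq> n" using na[of 1] T(2) j by (auto simp: tab_def)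
  then show "0 < j \<and> j < n \<and> i = min (f j) j + 1"
    using j na[of "min (f j) j + 1"] tab_col_le[OF f T(1)] by (auto simp: tab_def)
next
  assume j: "0 < j \<and> j < n \<and> i = min (f j) j + 1"
  then have "\<not> i' < i" if "(i', j) \<in> tab n f" for i'
    using tab_col_le[OF f that] by simp
  moreover have "(i, j) \<in> tab n f" using j by (simp add: tab_def)
  ultimately show "up_arrow n (tab n f) (i, j)"
    using j unfolding up_arrow_def above_def root_def by auto
qed

lemma tab_left_arrow_iff:
  assumes f: "f \<in> arrow_funs n"
  shows "left_arrow n (tab n f) (i, j) \<longleftrightarrow> 1 < i \<and> i \<le> n \<and> j = max (f (i - 1)) (i - 1)"
proof
  assume u: "left_arrow n (tab n f) (i, j)"
  then have T: "(i, j) \<in> tab n f" "(i, j) \<noteq> (1, n)"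
    and na: "\<And>j'. (i, j') \<in> tab n f \<Longrightarrow> \<not> j < j'"
    by (auto simp: left_arrow_def left_of_def root_def)
  have j: "j \<le> n" "0 < i" "i \<le> n"
    using T arrow_funsD(2)[OF f] by (auto simp: tab_def)
  have "i \<noteq> 1" using na[of n] T(2) j by (auto simp: tab_def)
  then show "1 < i \<and> i \<le> n \<and> j = max (f (i - 1)) (i - 1)"
    using j na[of "max (f (i - 1)) (i - 1)"] tab_row_le[OF f T(1)] by (auto simp: tab_def)
next
  assume j: "1 < i \<and> i \<le> n \<and> j = max (f (i - 1)) (i - 1)"
  then have "\<not> j < j'" if "(i, j') \<in> tab n f" for j'
    using tab_row_le[OF f that] by (metis leD)
  moreover have "(i, j) \<in> tab n f" using j by (simp add: tab_def)
  ultimately show "left_arrow n (tab n f) (i, j)"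
    using j unfolding left_arrow_def left_of_def root_def by auto
qed

lemma tab_cell_cases:
  assumes f: "f \<in> arrow_funs n" and "c \<in> tab n f"
  shows "c = root n \<or> up_arrow n (tab n f) c \<or> left_arrow n (tab n f) c"
proof -
  obtain i j where c: "c = (i, j)" by fastforce
  show ?thesis
    using assms(2) unfolding c tab_up_arrow_iff[OF f] tab_left_arrow_iff[OF f]
    by (auto simp: tab_def root_def)
qed

lemma tab_dot_iff:
  assumes f: "f \<in> arrow_funs n"
  shows "dot n (tab n f) c \<longleftrightarrow> c = root n"
  using tab_cell_cases[OF f] by (auto simp: dot_def up_arrow_def left_arrow_def tab_def root_def)

lemma tab_fb_tableau:
  assumes f: "f \<in> arrow_funs n" and n: "1 \<le> n"
  shows "fb_tableau n (tab n f)"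
proof -
  have "\<exists>d\<in>tab n f. left_of d (i, j) \<or> above d (i, j)"
    if T: "(i, j) \<in> tab n f" "(i, j) \<noteq> (1, n)" for i j
  proof (cases "0 < j \<and> j < n \<and> i = min (f j) j + 1")
    case True
    show ?thesis
    proof (cases "i = 1")
      case True
      then show ?thesis
        using T \<open>0 < j \<and> j < n \<and> _\<close> by (intro bexI[of _ "(1, n)"]) (auto simp: tab_def left_of_def)
    next
      case False
      have "j < max (f (i - 1)) (i - 1)"
        using True False arrow_funsD(3,4)[OF f, of j] by (cases "f j < j") auto
      then show ?thesis
        using True False
        by (intro bexI[of _ "(i, max (f (i - 1)) (i - 1))"]) (auto simp: tab_def left_of_def)
    qed
  next
    case False
    then have i: "1 < i" "i \<le> n" "j = max (f (i - 1)) (i - 1)" using T by (auto simp: tab_def)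
    show ?thesis
    proof (cases "j = n")
      case True
      then show ?thesis
        using i by (intro bexI[of _ "(1, n)"]) (auto simp: tab_def above_def)
    next
      case False
      moreover have "i - 1 \<le> j" "j \<le> n" using i arrow_funsD(2)[OF f, of "i - 1"] by auto
      ultimately have j: "0 < j" "j < n" using i(1) by linarith+
      have "min (f j) j + 1 < i"
        using i j arrow_funsD(3,5)[OF f, of "i - 1"] by (cases "i - 1 < f (i - 1)") auto
      then show ?thesis
        using j by (intro bexI[of _ "(min (f j) j + 1, j)"]) (auto simp: tab_def above_def)
    qed
  qed
  moreover have "border n \<subseteq> tab n f"
    by (auto simp: border_def tab_def)
  ultimately show ?thesis
    using tab_board[OF f n] by (auto simp: fb_tableau_def root_def tab_def)
qed

text \<open>The value at \<open>k\<close> is read off from the leftmost cell of row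
  \<open>k + 1\<close> and the topmost cell of column \<open>k\<close>; smallness makes exactly one
  of these differ from the border cell.\<close>

lemma small_fb_tableau_tab:
  assumes T: "fb_tableau n T" "small n T"
  obtains f where "f \<in> arrow_funs n" "T = tab n f"
proof -
  have board: "1 \<le> i \<and> i \<le> n \<and> 1 \<le> j \<and> i \<le> j + 1 \<and> j \<le> n" if "(i, j) \<in> T" for i j
    using that T(1) by (auto simp: fb_tableau_def board_def)
  have root: "(1, n) \<in> T" using T(1) by (simp add: fb_tableau_def root_def)
  have bord: "(k + 1, k) \<in> T" if "0 < k" "k < n" for k
    using that T(1) by (force simp: fb_tableau_def border_def)
  have fin: "finite T"
    using finite_subset[of T "{..n} \<times> {..n}"] board by fastforce
  text \<open>Since the only dot is the root, exactly one of the two arrow conditions holds at each other cell.\<close>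
  have arrow: "(\<exists>j'>j. (i, j') \<in> T) \<noteq> (\<exists>i'<i. (i', j) \<in> T)"
    if c: "(i, j) \<in> T" "(i, j) \<noteq> (1, n)" for i j
  proof -
    have "\<not> dot n T (i, j)" using c T(2) by (auto simp: small_def root_def)
    then have "\<not> (\<exists>j'>j. (i, j') \<in> T) \<or> \<not> (\<exists>i'<i. (i', j) \<in> T)"
      using c by (auto simp: dot_def left_arrow_def up_arrow_def left_of_def above_def)
    moreover have "(\<exists>j'>j. (i, j') \<in> T) \<or> (\<exists>i'<i. (i', j) \<in> T)"
      using c T(1) by (fastforce simp: fb_tableau_def root_def left_of_def above_def)
    ultimately show ?thesis by blast
  qed
  \<comment> \<open>Labels decrease from left to right, so the leftmost cell has the maximal label.
    The shift in \<open>c\<close> matches the convention that the up-arrow sits in row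
    \<open>f k + 1\<close>.\<close>
  define r where "r k = Max {j. (k + 1, j) \<in> T}" for k
  define c where "c k = Min {i. (i, k) \<in> T} - 1" for k
  have finr: "finite {j. (k, j) \<in> T}" "finite {i. (i, k) \<in> T}" for k
    by (rule finite_subset[of _ "snd ` T"]; use fin in force)
      (rule finite_subset[of _ "fst ` T"]; use fin in force)
  have rT: "(k + 1, r k) \<in> T" "k \<le> r k" and cT: "(c k + 1, k) \<in> T" "c k \<le> k"
    if k: "0 < k" "k < n" for k
  proof -
    have ne: "k \<in> {j. (k + 1, j) \<in> T}" "k + 1 \<in> {i. (i, k) \<in> T}" using bord k by auto
    show "(k + 1, r k) \<in> T" using Max_in[OF finr(1)[of "k + 1"]] ne(1) by (auto simp: r_def)
    show "k \<le> r k" using Max_ge[OF finr(1) ne(1)] by (simp add: r_def)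
    have "(Min {i. (i, k) \<in> T}, k) \<in> T" using Min_in[OF finr(2)[of k]] ne(2) by auto
    moreover from this have "1 \<le> Min {i. (i, k) \<in> T}" using board by blast
    ultimately show "(c k + 1, k) \<in> T" by (simp add: c_def)
    show "c k \<le> k" using Min_le[OF finr(2) ne(2)] by (simp add: c_def)
  qed
  have rmax: "j \<le> r k" if "(k + 1, j) \<in> T" for j k
    using Max_ge[OF finr(1)] that by (simp add: r_def)
  have cmin: "c k + 1 \<le> i" if "(i, k) \<in> T" for i k
  proof -
    have "Min {i. (i, k) \<in> T} \<le> i" using Min_le[OF finr(2)] that by simp
    then show ?thesis using board[OF that] unfolding c_def by linarith
  qed
  have dich: "(k < r k) \<noteq> (c k < k)" if k: "0 < k" "k < n" for k
  proof -
    have "(\<exists>j'>k. (k + 1, j') \<in> T) \<longleftrightarrow> k < r k" using rT[OF k] rmax by (meson less_le_trans)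
    moreover have "(\<exists>i'<k + 1. (i', k) \<in> T) \<longleftrightarrow> c k < k"
      using cT[OF k] cmin[of _ k] by (meson Suc_eq_plus1 add_less_cancel_right le_less_trans)
    ultimately show ?thesis using arrow[OF bord[OF k]] k by auto
  qed
  define f where "f k = (if \<not> (0 < k \<and> k < n) then 0 else if k < r k then r k else c k)" for k
  have max_f: "max (f k) k = r k" and min_f: "min (f k) k = c k" if k: "0 < k" "k < n" for k
    using dich[OF k] rT[OF k] cT[OF k] k by (auto simp: f_def)
  have "f \<in> arrow_funs n"
  proof (rule arrow_funsI)
    show "\<not> (0 < k \<and> k < n) \<Longrightarrow> f k = 0" for k by (simp add: f_def)
    fix k assume k: "0 < k" "k < n"
    show "f k \<le> n" using board[OF rT(1)[OF k]] cT(2)[OF k] k by (auto simp: f_def)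
    show "f k \<noteq> k" using dich[OF k] by (auto simp: f_def k)
    show "k < f (f k)" if a: "0 < f k" "f k < k"
    proof -
      have ck: "c k = f k" using min_f[OF k] a by simp
      have "\<not> (\<exists>i'<f k + 1. (i', k) \<in> T)" using cmin[of _ k] ck by (metis leD)
      \<comment> \<open>This cell has nothing above it, so by \<open>arrow\<close> there is a
        nonempty cell to its left.\<close>
      then obtain j where "k < j" "(f k + 1, j) \<in> T"
        using arrow[OF cT(1)[OF k]] a k ck by auto
      then have "k < r (f k)" using rmax by (meson less_le_trans)
      then show ?thesis using a k by (simp add: f_def[of "f k"])
    qed
    show "f (f k) < k" if a: "k < f k" "f k < n"
    proof -
      have rk: "r k = f k" using max_f[OF k] a by simp
      have "\<not> (\<exists>j'>f k. (k + 1, j') \<in> T)" using rmax[of k] rk by (metis leD)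
      then obtain i where i: "i < k + 1" "(i, f k) \<in> T"
        using arrow[OF rT(1)[OF k]] a k rk by auto
      have b: "0 < f k" using a by simp
      have "c (f k) < k" using cmin[OF i(2)] i(1) by simp
      then show ?thesis using min_f[OF b a(2)] a by (simp add: min_def split: if_splits)
    qed
  qed
  moreover have "T = tab n f"
  proof (intro equalityI subrelI)
    fix i j assume ij: "(i, j) \<in> T"
    show "(i, j) \<in> tab n f"
    proof (cases "(i, j) = (1, n)")
      case False
      note b = board[OF ij]
      show ?thesis
      proof (cases "\<exists>i'<i. (i', j) \<in> T")
        case True
        then have i: "1 < i" using board by fastforce
        then have k: "0 < i - 1" "i - 1 < n" using b by auto
        have "\<not> (\<exists>j'>j. (i, j') \<in> T)" using arrow[OF ij False] True by blast
        then have "j = r (i - 1)"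
          using rmax[of "i - 1" j] rT(1)[OF k] ij i by (auto simp: not_less intro: antisym)
        then show ?thesis using max_f[OF k] i b by (simp add: tab_def)
      next
        case upper: False
        then have left: "\<exists>j'>j. (i, j') \<in> T" using arrow[OF ij False] by blast
        then have j: "0 < j" "j < n" using b board by fastforce+
        have "c j + 1 = i" using cmin[OF ij] cT(1)[OF j] upper by (auto simp: not_less intro: antisym)
        then show ?thesis using min_f[OF j] j by (simp add: tab_def)
      qed
    qed (simp add: tab_def)
  next
    fix i j assume "(i, j) \<in> tab n f"
    then consider "i = 1" "j = n" | "0 < j" "j < n" "i = min (f j) j + 1"
      | "1 < i" "i \<le> n" "j = max (f (i - 1)) (i - 1)"
      by (auto simp: tab_def)
    then show "(i, j) \<in> T"
    proof cases
      case 2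
      then show ?thesis using min_f cT(1) by simp
    next
      case 3
      then show ?thesis using max_f[of "i - 1"] rT(1)[of "i - 1"] by simp
    qed (use root in simp)
  qed
  ultimately show ?thesis using that by blast
qed

section \<open>The encoding as an order-reversing bijection\<close>

lemma tab_Col:
  assumes f: "f \<in> arrow_funs n"
  shows "Col n (tab n f) = {(i, j) \<in> board n. j < n \<longrightarrow> min (f j) j < i}"
proof -
  have "(\<exists>d. (up_arrow n (tab n f) d \<or> d = root n) \<and> (d = (i, j) \<or> above d (i, j))) \<longleftrightarrow>
      (j < n \<longrightarrow> min (f j) j < i)" if "(i, j) \<in> board n" for i j
  proof -
    have b: "1 \<le> i" "1 \<le> j" "j \<le> n" using that by (auto simp: board_def)
    have "(\<exists>d. (up_arrow n (tab n f) d \<or> d = root n) \<and> (d = (i, j) \<or> above d (i, j))) \<longleftrightarrow>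
      (\<exists>i'\<le>i. up_arrow n (tab n f) (i', j) \<or> (i', j) = (1, n))"
      by (auto simp: above_def root_def le_less)
    then show ?thesis using b by (auto simp: tab_up_arrow_iff[OF f] less_eq_Suc_le)
  qed
  then show ?thesis by (auto simp: Col_def)
qed

lemma tab_Row:
  assumes f: "f \<in> arrow_funs n"
  shows "Row n (tab n f) = {(i, j) \<in> board n. 1 < i \<longrightarrow> j \<le> max (f (i - 1)) (i - 1)}"
proof -
  have "(\<exists>d. (left_arrow n (tab n f) d \<or> d = root n) \<and> (d = (i, j) \<or> left_of d (i, j))) \<longleftrightarrow>
      (1 < i \<longrightarrow> j \<le> max (f (i - 1)) (i - 1))" if "(i, j) \<in> board n" for i j
  proof -
    have b: "1 \<le> i" "1 \<le> j" "i \<le> n" "j \<le> n" using that by (auto simp: board_def)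
    have "(\<exists>d. (left_arrow n (tab n f) d \<or> d = root n) \<and> (d = (i, j) \<or> left_of d (i, j))) \<longleftrightarrow>
      (\<exists>j'\<ge>j. left_arrow n (tab n f) (i, j') \<or> (i, j') = (1, n))"
      by (auto simp: left_of_def root_def le_less)
    then show ?thesis using b by (auto simp: tab_left_arrow_iff[OF f])
  qed
  then show ?thesis by (auto simp: Row_def)
qed

text \<open>Inclusion of the column sets compares \<open>min (f k) k\<close>, inclusion of the row
  sets compares \<open>max (f k) k\<close>, and since \<open>f k \<noteq> k\<close> both together
  compare \<open>f k\<close>. The only dot, the root, is not free, which settles the third clause of
  \<open>fb_le\<close>.\<close>

lemma tab_fb_le_iff:
  assumes f: "f \<in> arrow_funs n" and g: "g \<in> arrow_funs n"
  shows "fb_le n (tab n f) (tab n g) \<longleftrightarrow> g \<le> f"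
proof
  assume le: "fb_le n (tab n f) (tab n g)"
  then have C: "Col n (tab n f) \<subseteq> Col n (tab n g)" and R: "Row n (tab n g) \<subseteq> Row n (tab n f)"
    by (auto simp: fb_le_def)
  show "g \<le> f"
  proof (rule arrow_fun_le[OF g])
    fix k assume k: "0 < k" "k < n"
    have "(min (f k) k + 1, k) \<in> Col n (tab n f)"
      unfolding tab_Col[OF f] using k by (auto simp: board_def)
    then have 1: "min (g k) k \<le> min (f k) k"
      using C k unfolding tab_Col[OF g] by auto
    have "(k + 1, max (g k) k) \<in> Row n (tab n g)"
      unfolding tab_Row[OF g] using k arrow_funsD(2)[OF g, of k] by (auto simp: board_def)
    then have "max (g k) k \<le> max (f k) k"
      using R k unfolding tab_Row[OF f] by auto
    then show "g k \<le> f k" using 1 arrow_funsD(3)[OF f k] by (auto simp: min_def max_def split: if_splits)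
  qed
next
  assume "g \<le> f"
  then have le: "g k \<le> f k" for k by (simp add: le_fun_def)
  have mm: "min (g k) k \<le> min (f k) k" "max (g k) k \<le> max (f k) k" for k
    using le[of k] by auto
  have "Col n (tab n f) \<subseteq> Col n (tab n g)"
    unfolding tab_Col[OF f] tab_Col[OF g]
    by (intro subrelI) (simp only: mem_Collect_eq case_prod_conv, meson mm(1) le_less_trans)
  moreover have "Row n (tab n g) \<subseteq> Row n (tab n f)"
    unfolding tab_Row[OF f] tab_Row[OF g]
    by (intro subrelI) (simp only: mem_Collect_eq case_prod_conv, meson mm(2) le_trans)
  moreover have "\<not> free_cell n (tab n f) (root n)"
    by (auto simp: free_cell_def root_def above_def tab_up_arrow_iff[OF f])
  ultimately show "fb_le n (tab n f) (tab n g)"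
    by (auto simp: fb_le_def tab_dot_iff[OF f])
qed

lemma sTam_carrier:
  assumes "1 \<le> n"
  shows "carrier (sTam n) = tab n ` arrow_funs n"
proof (intro equalityI subsetI)
  fix T assume "T \<in> carrier (sTam n)"
  then show "T \<in> tab n ` arrow_funs n"
    using small_fb_tableau_tab[of n T] by (auto simp: sTam_def)
next
  fix T assume "T \<in> tab n ` arrow_funs n"
  then obtain f where f: "f \<in> arrow_funs n" "T = tab n f" by blast
  have "{c. dot n (tab n f) c} = {root n}" using tab_dot_iff[OF f(1)] by blast
  then show "T \<in> carrier (sTam n)"
    using tab_fb_tableau[OF f(1) assms] f(2) by (simp add: sTam_def small_def)
qed

lemma sTam_tab_le:
  assumes "f \<in> arrow_funs n" "g \<in> arrow_funs n"
  shows "le (sTam n) (tab n f) (tab n g) \<longleftrightarrow> g \<le> f"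
  using tab_fb_le_iff[OF assms] by (simp add: sTam_def)

lemma inj_on_tab: "inj_on (tab n) (arrow_funs n)"
  by (rule inj_onI) (metis tab_fb_le_iff order.antisym order.refl)

lemma sTam_partial_order:
  assumes "1 \<le> n"
  shows "partial_order (sTam n)"
proof -
  have eq: "eq (sTam n) = (=)" by (simp add: sTam_def)
  note c = sTam_carrier[OF assms]
  show ?thesis
  proof unfold_locales
    show "x .=\<^bsub>sTam n\<^esub> y" if "le (sTam n) x y" "le (sTam n) y x" "x \<in> carrier (sTam n)" "y \<in> carrier (sTam n)" for x y
      using that unfolding c eq by (auto simp: sTam_tab_le dest: antisym)
    show "le (sTam n) x z" if "le (sTam n) x y" "le (sTam n) y z"
      "x \<in> carrier (sTam n)" "y \<in> carrier (sTam n)" "z \<in> carrier (sTam n)" for x y z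
      using that unfolding c by (auto simp: sTam_tab_le)
  qed (auto simp: eq c sTam_tab_le)
qed

text \<open>The encoding reverses the order, hence the exchange of meet and join. Both are picked by
  choice, and uniqueness of greatest and least elements identifies them.\<close>

lemma sTam_meet_join:
  assumes n: "1 \<le> n" and f: "f \<in> arrow_funs n" and g: "g \<in> arrow_funs n"
  shows "tab n f \<sqinter>\<^bsub>sTam n\<^esub> tab n g = tab n (arrow_join n f g)"
    and "tab n f \<squnion>\<^bsub>sTam n\<^esub> tab n g = tab n (arrow_meet n f g)"
proof -
  interpret partial_order "sTam n" by (rule sTam_partial_order[OF n])
  note c = sTam_carrier[OF n]
  have "greatest (sTam n) (tab n (arrow_join n f g)) (Lower (sTam n) {tab n f, tab n g})"
    unfolding greatest_def Lower_def c
    using f g arrow_join_closed[OF f g] arrow_join_upper[OF f g] arrow_join_least[OF f g]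
    by (auto simp: sTam_tab_le)
  then show "tab n f \<sqinter>\<^bsub>sTam n\<^esub> tab n g = tab n (arrow_join n f g)"
    unfolding meet_def inf_def by (metis someI greatest_unique)
  have "least (sTam n) (tab n (arrow_meet n f g)) (Upper (sTam n) {tab n f, tab n g})"
    unfolding least_def Upper_def c
    using f g arrow_meet_closed[OF f g] arrow_meet_lower[OF f g] arrow_meet_greatest[OF f g]
    by (auto simp: sTam_tab_le)
  then show "tab n f \<squnion>\<^bsub>sTam n\<^esub> tab n g = tab n (arrow_meet n f g)"
    unfolding join_def sup_def by (metis someI least_unique)
qed

section \<open>Transport of congruences along the encoding\<close>

lemma map_prod_image_mem_iff:
  assumes "inj_on h A" "R \<subseteq> A \<times> A" "x \<in> A" "y \<in> A"
  shows "(h x, h y) \<in> map_prod h h ` R \<longleftrightarrow> (x, y) \<in> R"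
proof
  assume "(h x, h y) \<in> map_prod h h ` R"
  then obtain u v where uv: "(u, v) \<in> R" "h x = h u" "h y = h v" by auto
  then have "x = u" "y = v" using assms by (blast dest: inj_onD)+
  then show "(x, y) \<in> R" using uv by simp
qed force

lemma equiv_map_prod_iff:
  assumes "inj_on h A" "R \<subseteq> A \<times> A"
  shows "equiv (h ` A) (map_prod h h ` R) \<longleftrightarrow> equiv A R"
proof -
  have mem: "(h x, h y) \<in> map_prod h h ` R \<longleftrightarrow> (x, y) \<in> R" if "x \<in> A" "y \<in> A" for x y
    using map_prod_image_mem_iff[OF assms that] .
  have sub: "map_prod h h ` R \<subseteq> h ` A \<times> h ` A" using assms(2) by force
  have "refl_on (h ` A) (map_prod h h ` R) \<longleftrightarrow> refl_on A R"
    using mem by (auto simp: refl_on_def)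
  moreover have "sym (map_prod h h ` R) \<longleftrightarrow> sym R"
  proof
    assume S: "sym (map_prod h h ` R)"
    show "sym R"
    proof (rule symI)
      fix x y assume xy: "(x, y) \<in> R"
      then have "(h y, h x) \<in> map_prod h h ` R" using S by (meson map_prod_imageI symE)
      moreover have "x \<in> A" "y \<in> A" using xy assms(2) by auto
      ultimately show "(y, x) \<in> R" using mem[of y x] by simp
    qed
  next
    assume S: "sym R"
    show "sym (map_prod h h ` R)"
    proof (rule symI)
      fix x y assume "(x, y) \<in> map_prod h h ` R"
      then obtain u v where "x = h u" "y = h v" "(u, v) \<in> R" by auto
      then show "(y, x) \<in> map_prod h h ` R" using symD[OF S] by blast
    qed
  qed
  moreover have "trans (map_prod h h ` R) \<longleftrightarrow> trans R"
  proof
    assume S: "trans (map_prod h h ` R)"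
    show "trans R"
    proof (rule transI)
      fix x y z assume xy: "(x, y) \<in> R" "(y, z) \<in> R"
      then have "(h x, h z) \<in> map_prod h h ` R" using S by (meson map_prod_imageI transE)
      moreover have "x \<in> A" "z \<in> A" using xy assms(2) by auto
      ultimately show "(x, z) \<in> R" using mem[of x z] by simp
    qed
  next
    assume S: "trans R"
    show "trans (map_prod h h ` R)"
    proof (rule transI)
      fix x y z assume xy: "(x, y) \<in> map_prod h h ` R" "(y, z) \<in> map_prod h h ` R"
      obtain u v where u: "x = h u" "y = h v" "(u, v) \<in> R" using xy(1) by auto
      obtain v' w where w: "y = h v'" "z = h w" "(v', w) \<in> R" using xy(2) by auto
      note uv = u w
      have "v \<in> A" "v' \<in> A" using uv assms(2) by auto
      then have "v = v'" using uv inj_onD[OF assms(1)] by blast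
      then show "(x, z) \<in> map_prod h h ` R" using uv transD[OF S] by blast
    qed
  qed
  ultimately show ?thesis using assms(2) sub by (auto simp: equiv_def)
qed

text \<open>A congruence respects both operations, so it may be transported along a bijection that
  exchanges them.\<close>

lemma card_congruence_lattice_sTam:
  assumes n: "1 \<le> n"
  shows "card (carrier (congruence_lattice (sTam n))) = card (arrow_congs n)"
proof -
  let ?h = "map_prod (tab n) (tab n)"
  note c = sTam_carrier[OF n]
  have cong_iff: "lattice_congruence (sTam n) (?h ` R) \<longleftrightarrow> R \<in> arrow_congs n"
    if sub: "R \<subseteq> arrow_funs n \<times> arrow_funs n" for R
  proof -
    have mem: "(tab n f, tab n g) \<in> ?h ` R \<longleftrightarrow> (f, g) \<in> R" if "f \<in> arrow_funs n" "g \<in> arrow_funs n" for f g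
      using map_prod_image_mem_iff[OF inj_on_tab sub that] .
    let ?P = "\<lambda>x x' y y'. (x \<sqinter>\<^bsub>sTam n\<^esub> y, x' \<sqinter>\<^bsub>sTam n\<^esub> y') \<in> ?h ` R \<and> (x \<squnion>\<^bsub>sTam n\<^esub> y, x' \<squnion>\<^bsub>sTam n\<^esub> y') \<in> ?h ` R"
    have "(\<forall>x x' y y'. (x, x') \<in> ?h ` R \<longrightarrow> (y, y') \<in> ?h ` R \<longrightarrow> ?P x x' y y') \<longleftrightarrow>
      (\<forall>f f' g g'. (f, f') \<in> R \<longrightarrow> (g, g') \<in> R \<longrightarrow> ?P (tab n f) (tab n f') (tab n g) (tab n g'))"
      (is "?l \<longleftrightarrow> ?r")
    proof
      assume ?l
      then show ?r using map_prod_imageI[of _ _ R "tab n" "tab n"] by blast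
    next
      assume r: ?r
      show ?l
      proof (intro allI impI)
        fix x x' y y' assume "(x, x') \<in> ?h ` R" "(y, y') \<in> ?h ` R"
        then show "?P x x' y y'" using r by (elim imageE) (simp only: prod.inject map_prod_def case_prod_beta, metis prod.collapse)
      qed
    qed
    also have "\<dots> \<longleftrightarrow> (\<forall>f f' g g'. (f, f') \<in> R \<longrightarrow> (g, g') \<in> R \<longrightarrow>
        (arrow_meet n f g, arrow_meet n f' g') \<in> R \<and> (arrow_join n f g, arrow_join n f' g') \<in> R)"
    proof -
      have "?P (tab n f) (tab n f') (tab n g) (tab n g') \<longleftrightarrow>
          (arrow_meet n f g, arrow_meet n f' g') \<in> R \<and> (arrow_join n f g, arrow_join n f' g') \<in> R"
        if "(f, f') \<in> R" "(g, g') \<in> R" for f f' g g'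
      proof -
        have m: "f \<in> arrow_funs n" "f' \<in> arrow_funs n" "g \<in> arrow_funs n" "g' \<in> arrow_funs n"
          using that sub by auto
        show ?thesis
          unfolding sTam_meet_join[OF n m(1,3)] sTam_meet_join[OF n m(2,4)]
            mem[OF arrow_join_closed[OF m(1,3)] arrow_join_closed[OF m(2,4)]]
            mem[OF arrow_meet_closed[OF m(1,3)] arrow_meet_closed[OF m(2,4)]] by blast
      qed
      note ptw = this
      show ?thesis by (intro iff_allI imp_cong refl ptw)
    qed
    finally show ?thesis
      unfolding lattice_congruence_def arrow_congs_def c mem_Collect_eq
        equiv_map_prod_iff[OF inj_on_tab sub] by simp
  qed
  have "bij_betw ((`) ?h) (arrow_congs n) {R. lattice_congruence (sTam n) R}"
  proof (rule bij_betw_imageI)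
    have sub: "R \<subseteq> arrow_funs n \<times> arrow_funs n" if "R \<in> arrow_congs n" for R
      using arrow_congsD(1,2)[OF that] by auto
    have "inj_on ?h (arrow_funs n \<times> arrow_funs n)"
      using inj_on_tab by (simp add: map_prod_inj_on)
    then show "inj_on ((`) ?h) (arrow_congs n)"
      using sub by (meson inj_onI inj_on_image_eq_iff)
    show "(`) ?h ` arrow_congs n = {R. lattice_congruence (sTam n) R}"
    proof (intro equalityI subsetI)
      fix S assume "S \<in> {R. lattice_congruence (sTam n) R}"
      then have S: "lattice_congruence (sTam n) S" by simp
      then have "S \<subseteq> tab n ` arrow_funs n \<times> tab n ` arrow_funs n"
        using equiv_type by (auto simp: lattice_congruence_def c)
      then have "S \<subseteq> ?h ` (arrow_funs n \<times> arrow_funs n)" by force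
      then obtain R where R: "R \<subseteq> arrow_funs n \<times> arrow_funs n" "S = ?h ` R"
        by (meson subset_imageE)
      then show "S \<in> (`) ?h ` arrow_congs n" using cong_iff S by blast
    qed (use cong_iff sub in blast)
  qed
  then show ?thesis by (simp add: congruence_lattice_def bij_betw_same_card)
qed

section \<open>Closed sets of conditions and Dyck paths\<close>

text \<open>Sets of nonempty intervals in \<open>{1..n-1}\<close> closed under passing to nonempty
  subintervals, stated through removal of one endpoint.\<close>

definition interval_ideal :: "nat \<Rightarrow> (nat \<times> nat) set \<Rightarrow> bool" where
  "interval_ideal n I \<longleftrightarrow> I \<subseteq> {(i, j). 0 < i \<and> i \<le> j \<and> j < n} \<and>
     (\<forall>i j. (i, j) \<in> I \<and> i < j \<longrightarrow> (i, j - 1) \<in> I \<and> (i + 1, j) \<in> I)"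

lemma interval_idealD:
  assumes "interval_ideal n I"
  shows "(i, j) \<in> I \<Longrightarrow> 0 < i \<and> i \<le> j \<and> j < n"
    and "\<lbrakk>(i, j) \<in> I; i < j\<rbrakk> \<Longrightarrow> (i, j - 1) \<in> I"
    and "\<lbrakk>(i, j) \<in> I; i < j\<rbrakk> \<Longrightarrow> (i + 1, j) \<in> I"
  using assms by (auto simp: interval_ideal_def)

lemma interval_ideal_sub:
  assumes I: "interval_ideal n I" and "(i, j) \<in> I" "i \<le> i'" "i' \<le> j'" "j' \<le> j"
  shows "(i', j') \<in> I"
proof -
  have "(i', j) \<in> I" using assms(3)
  proof (induction rule: dec_induct)
    case base
    show ?case by (rule assms(2))
  next
    case (step k)
    have "k < j" using step assms by linarith
    then show ?case using interval_idealD(3)[OF I step.IH] by simp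
  qed
  with assms(5) show ?thesis
  proof (induction rule: inc_induct)
    case (step k)
    have "i' < Suc k" using step assms(4) by linarith
    then show ?case using interval_idealD(2)[OF I step.IH] step.prems by simp
  qed simp
qed

definition condition_support :: "(nat \<times> nat) set \<Rightarrow> (nat \<times> nat) set" where
  "condition_support N = {(i, j). 0 < i \<and> i \<le> j \<and> ((i, j) \<in> N \<or> (j, i - 1) \<in> N)}"

lemma condition_support_ideal:
  assumes N: "N \<in> closed_conditions n"
  shows "interval_ideal n (condition_support N)"
proof -
  note D = closed_conditionsD[OF N]
  have "0 < i \<and> i \<le> j \<and> j < n" if "(i, j) \<in> condition_support N" for i j
    using that D(1) by (auto simp: condition_support_def)
  moreover have "(i, j - 1) \<in> condition_support N \<and> (i + 1, j) \<in> condition_support N"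
    if "(i, j) \<in> condition_support N" "i < j" for i j
  proof -
    have "0 < i" "j < n" "(i, j) \<in> N \<or> (j, i - 1) \<in> N" using that D(1) by (auto simp: condition_support_def)
    then have "(i, j - 1) \<in> N" "(j, i) \<in> N" using D(3,4) that(2) by blast+
    then show ?thesis using \<open>0 < i\<close> that(2) by (auto simp: condition_support_def)
  qed
  ultimately show ?thesis unfolding interval_ideal_def by blast
qed

text \<open>Below, \<open>True\<close> stands for the condition \<open>(i, j)\<close> and \<open>False\<close> for \<open>(j, i - 1)\<close>.\<close>

definition choices :: "(nat \<times> nat) set \<Rightarrow> nat \<times> nat \<Rightarrow> bool set set" where
  "choices I = (\<lambda>(i, j). {S. S \<noteq> {} \<and> ((i, j + 1) \<in> I \<longrightarrow> True \<in> S) \<and>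
     ((i - 1, j) \<in> I \<longrightarrow> False \<in> S) \<and> (i = j \<longrightarrow> S = UNIV)})"

text \<open>With nothing forced, the \<open>2 * 2\<close> subsets lose only the empty one; a forced
  element already excludes the empty set.\<close>

lemma card_choices:
  "card (choices I (i, j)) =
     (if i = j then 1
      else (if (i, j + 1) \<in> I then 1 else 2) * (if (i - 1, j) \<in> I then 1 else 2)
        - (if (i, j + 1) \<in> I \<or> (i - 1, j) \<in> I then 0 else 1))"
proof -
  have "choices I (i, j) = {{}, {True}, {False}, {True, False}} \<inter>
      {S. S \<noteq> {} \<and> ((i, j + 1) \<in> I \<longrightarrow> True \<in> S) \<and> ((i - 1, j) \<in> I \<longrightarrow> False \<in> S) \<and> (i = j \<longrightarrow> S = {True, False})}"
  proof -
    have "S \<in> {{}, {True}, {False}, {True, False}}" for S :: "bool set"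
    proof -
      have "S \<in> Pow {True, False}" by auto
      then show ?thesis by (auto simp: Pow_insert)
    qed
    then show ?thesis unfolding choices_def UNIV_bool by blast
  qed
  then show ?thesis
    by (cases "i = j"; cases "(i, j + 1) \<in> I"; cases "(i - 1, j) \<in> I")
      (simp_all add: Int_insert_left insert_commute)
qed

text \<open>Every condition belongs to exactly one interval, and once the support \<open>I\<close>
  is fixed, the closure rules only say which conditions are forced at each interval. The choices at
  different intervals are therefore independent.\<close>

lemma card_closed_conditions_support:
  assumes I: "interval_ideal n I"
  shows "card {N \<in> closed_conditions n. condition_support N = I} = (\<Prod>c\<in>I. card (choices I c))"
proof -
  note ID = interval_idealD[OF I]
  have "finite I"
    by (rule finite_subset[of _ "{..n} \<times> {..n}"]) (use ID(1) in fastforce)+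
  define G where "G N = (\<lambda>(i, j)\<in>I. {b. if b then (i, j) \<in> N else (j, i - 1) \<in> N})" for N :: "(nat \<times> nat) set"
  \<comment> \<open>Inverse of \<open>G\<close>: \<open>(x, y)\<close> is the first condition at
    \<open>[x, y]\<close> if \<open>x \<le> y\<close>, and the second one at
    \<open>[y + 1, x]\<close> otherwise.\<close>
  define F where "F g = {(x, y). (x \<le> y \<and> (x, y) \<in> I \<and> True \<in> g (x, y)) \<or>
      (y < x \<and> (y + 1, x) \<in> I \<and> False \<in> g (y + 1, x))}" for g :: "nat \<times> nat \<Rightarrow> bool set"
  have F: "(i, j) \<in> F g \<longleftrightarrow> (i, j) \<in> I \<and> True \<in> g (i, j)"
    "(j, i - 1) \<in> F g \<longleftrightarrow> (i, j) \<in> I \<and> False \<in> g (i, j)" if "0 < i" "i \<le> j" for g i j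
    using that by (auto simp: F_def)
  have "bij_betw G {N \<in> closed_conditions n. condition_support N = I} (Pi\<^sub>E I (choices I))"
  proof (rule bij_betw_byWitness[where f' = F])
    show "\<forall>N\<in>{N \<in> closed_conditions n. condition_support N = I}. F (G N) = N"
    proof safe
      fix N assume N: "N \<in> closed_conditions n" "I = condition_support N"
      have *: "(x, y) \<in> F (G N) \<longleftrightarrow> (x, y) \<in> N" for x y
      proof (cases "x \<le> y")
        case True
        then show ?thesis
          using closed_conditionsD(1)[OF N(1), of x y]
          by (auto simp: F_def G_def N(2) condition_support_def)
      next
        case False
        then show ?thesis
          using closed_conditionsD(1)[OF N(1), of x y]
          by (auto simp: F_def G_def N(2) condition_support_def)
      qed
      show "(x, y) \<in> F (G N) \<Longrightarrow> (x, y) \<in> N" "(x, y) \<in> N \<Longrightarrow> (x, y) \<in> F (G N)" for x y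
        using * by blast+
    qed
    show "\<forall>g\<in>Pi\<^sub>E I (choices I). G (F g) = g"
    proof
      fix g assume g: "g \<in> Pi\<^sub>E I (choices I)"
      have "G (F g) (i, j) = g (i, j)" for i j
      proof (cases "(i, j) \<in> I")
        case True
        then have "0 < i" "i \<le> j" using ID(1) by auto
        then have "G (F g) (i, j) = {b. if b then True \<in> g (i, j) else False \<in> g (i, j)}"
          using True F[of i j g] by (simp add: G_def)
        also have "\<dots> = g (i, j)"
        proof (rule Set.set_eqI)
          show "b \<in> {b. if b then True \<in> g (i, j) else False \<in> g (i, j)} \<longleftrightarrow> b \<in> g (i, j)" for b
            by (cases b) simp_all
        qed
        finally show ?thesis .
      next
        case False
        then show ?thesis using g by (auto simp: G_def PiE_def extensional_def)
      qed
      then show "G (F g) = g" by (auto simp: fun_eq_iff)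
    qed
    show "G ` {N \<in> closed_conditions n. condition_support N = I} \<subseteq> Pi\<^sub>E I (choices I)"
    proof (rule image_subsetI)
      fix N assume "N \<in> {N \<in> closed_conditions n. condition_support N = I}"
      then have N: "N \<in> closed_conditions n" "I = condition_support N" by auto
      note D = closed_conditionsD[OF N(1)]
      have mem: "{b. if b then (i, j) \<in> N else (j, i - 1) \<in> N} \<in> choices I (i, j)" if ij: "(i, j) \<in> I" for i j
      proof -
        have b: "0 < i" "i \<le> j" "j < n" using ID(1) ij by auto
        have "(i, j) \<in> N \<or> (j, i - 1) \<in> N" using ij by (simp add: N(2) condition_support_def)
        then have ne: "{b. if b then (i, j) \<in> N else (j, i - 1) \<in> N} \<noteq> {}" by auto
        have 1: "(i, j) \<in> N" if "(i, j + 1) \<in> I"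
        proof -
          have "j + 1 < n" "(i, j + 1) \<in> N \<or> (j + 1, i - 1) \<in> N"
            using ID(1)[OF that] that unfolding N(2) condition_support_def by simp_all
          then show ?thesis using D(3)[of i "j + 1"] b by simp
        qed
        have 2: "(j, i - 1) \<in> N" if "(i - 1, j) \<in> I"
        proof -
          have "0 < i - 1" "(i - 1, j) \<in> N \<or> (j, i - 1 - 1) \<in> N"
            using ID(1)[OF that] that unfolding N(2) condition_support_def by simp_all
          then show ?thesis using D(4)[of "i - 1" j] b by simp
        qed
        have 3: "(i, j) \<in> N \<and> (j, i - 1) \<in> N" if "i = j"
          using D(2)[of j] b \<open>(i, j) \<in> N \<or> (j, i - 1) \<in> N\<close> that by blast
        have 4: "{b. if b then (i, j) \<in> N else (j, i - 1) \<in> N} = UNIV" if "i = j"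
          using 3[OF that] by simp
        show ?thesis unfolding choices_def using ne 1 2 4 by simp
      qed
      show "G N \<in> Pi\<^sub>E I (choices I)"
      proof (rule PiE_I)
        fix c assume c: "c \<in> I"
        obtain i j where ij: "c = (i, j)" by fastforce
        have "G N c = {b. if b then (i, j) \<in> N else (j, i - 1) \<in> N}"
          using c by (simp add: G_def ij)
        then show "G N c \<in> choices I c" using mem c unfolding ij by metis
      qed (simp add: G_def)
    qed
    show "F ` Pi\<^sub>E I (choices I) \<subseteq> {N \<in> closed_conditions n. condition_support N = I}"
    proof safe
      fix g assume g: "g \<in> Pi\<^sub>E I (choices I)"
      have c: "g (i, j) \<noteq> {}" "(i, j + 1) \<in> I \<Longrightarrow> True \<in> g (i, j)"
        "(i - 1, j) \<in> I \<Longrightarrow> False \<in> g (i, j)" "i = j \<Longrightarrow> g (i, j) = UNIV" if "(i, j) \<in> I" for i j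
        using PiE_mem[OF g that] by (auto simp: choices_def)
      show "F g \<in> closed_conditions n"
        unfolding closed_conditions_def mem_Collect_eq
      proof (intro conjI allI impI)
        show "F g \<subseteq> conditions n"
          using ID(1) by (fastforce simp: F_def conditions_def)
        show "(k, k) \<in> F g \<longleftrightarrow> (k, k - 1) \<in> F g" if "0 < k \<and> k < n" for k
          using F[of k k g] c(4)[of k k] that by auto
        fix i j assume A: "0 < i \<and> i < j \<and> j < n \<and> ((i, j) \<in> F g \<or> (j, i - 1) \<in> F g)"
        then have ij: "(i, j) \<in> I" using F[of i j g] by auto
        have "(i, j - 1) \<in> I" "(i + 1, j) \<in> I" using ID(2,3)[OF ij] A by auto
        moreover have "True \<in> g (i, j - 1)" "False \<in> g (i + 1, j)"
          using c(2)[OF \<open>(i, j - 1) \<in> I\<close>] c(3)[OF \<open>(i + 1, j) \<in> I\<close>] ij A by auto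
        ultimately show "(i, j - 1) \<in> F g" "(j, i) \<in> F g"
          using F(1)[of i "j - 1" g] F(2)[of "i + 1" j g] A by auto
      qed
      have S: "(i, j) \<in> condition_support (F g) \<longleftrightarrow> (i, j) \<in> I" for i j
      proof (cases "0 < i \<and> i \<le> j")
        case True
        then have "(i, j) \<in> condition_support (F g) \<longleftrightarrow> (i, j) \<in> I \<and> (True \<in> g (i, j) \<or> False \<in> g (i, j))"
          using F[of i j g] by (auto simp: condition_support_def)
        also have "\<dots> \<longleftrightarrow> (i, j) \<in> I" using c(1)[of i j] by (metis (full_types) all_not_in_conv)
        finally show ?thesis .
      next
        case False
        then show ?thesis using ID(1)[of i j] by (auto simp: condition_support_def)
      qed
      show "(i, j) \<in> condition_support (F g) \<Longrightarrow> (i, j) \<in> I" "(i, j) \<in> I \<Longrightarrow> (i, j) \<in> condition_support (F g)" for i j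
        using S by blast+
    qed
  qed
  then have "card {N \<in> closed_conditions n. condition_support N = I} = card (Pi\<^sub>E I (choices I))"
    by (rule bij_betw_same_card)
  then show ?thesis using card_PiE[OF \<open>finite I\<close>] by simp
qed

section \<open>Heights along Dyck paths\<close>

lemma height_at_step:
  assumes "dyck_path n p" "k < 2 * n"
  shows "height_at p (Suc k) = height_at p k + 1 \<or> height_at p (Suc k) = height_at p k - 1"
proof -
  have "k < length p" "set p \<subseteq> {1, -1}" using assms by (auto simp: dyck_path_def)
  then have "k < length p" "p ! k \<in> {1, -1}" using nth_mem by blast+
  then show ?thesis by (auto simp: height_at_def take_Suc_conv_app_nth)
qed

lemma height_at_bounds:
  assumes p: "dyck_path n p" and "k \<le> 2 * n"
  shows "0 \<le> height_at p k" "height_at p k \<le> int k" "height_at p k \<le> 2 * int n - int k"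
    "even (height_at p k + int k)"
proof -
  show "0 \<le> height_at p k" using assms by (simp add: dyck_path_def)
  have "height_at p k \<le> int k \<and> even (height_at p k + int k)"
    using assms(2)
  proof (induction k)
    case (Suc k)
    then show ?case using height_at_step[OF p, of k] by auto
  qed (simp add: height_at_def)
  then show "height_at p k \<le> int k" "even (height_at p k + int k)" by auto
  show "height_at p k \<le> 2 * int n - int k"
    using assms(2)
  proof (induction rule: inc_induct)
    case base
    then show ?case using p by (simp add: dyck_path_def)
  next
    case (step k)
    then show ?case using height_at_step[OF p, of k] by auto
  qed
qed

lemma dyck_path_eqI:
  assumes p: "dyck_path n p" and q: "dyck_path n q"
    and eq: "\<And>k. k \<le> 2 * n \<Longrightarrow> height_at p k = height_at q k"
  shows "p = q"
proof (rule nth_equalityI)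
  show len: "length p = length q" using p q by (simp add: dyck_path_def)
  show "p ! k = q ! k" if "k < length p" for k
  proof -
    have "height_at p (Suc k) = height_at p k + p ! k" "height_at q (Suc k) = height_at q k + q ! k"
      using that len by (auto simp: height_at_def take_Suc_conv_app_nth)
    then show ?thesis using eq[of k] eq[of "Suc k"] that p by (auto simp: dyck_path_def)
  qed
qed

lemma finite_dyck_paths: "finite {p. dyck_path n p}"
  by (rule finite_subset[OF _ finite_lists_length_eq[of "{1, -1}" "2 * n"]]) (auto simp: dyck_path_def)

section \<open>Dyck paths and ideals of intervals\<close>

text \<open>The interval \<open>[i, j]\<close> is the cell with centre
  \<open>(i + j, j - i + 1)\<close>; the inequality says that its top vertex lies weakly below the
  path.\<close>

definition path_intervals :: "nat \<Rightarrow> int list \<Rightarrow> (nat \<times> nat) set" where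
  "path_intervals n p = {(i, j). 0 < i \<and> i \<le> j \<and> j < n \<and> int j - int i + 2 \<le> height_at p (i + j)}"

lemma path_intervals_ideal:
  assumes p: "dyck_path n p"
  shows "interval_ideal n (path_intervals n p)"
proof -
  have "(i, j - 1) \<in> path_intervals n p \<and> (i + 1, j) \<in> path_intervals n p"
    if ij: "(i, j) \<in> path_intervals n p" "i < j" for i j
  proof -
    have b: "0 < i" "j < n" "int j - int i + 2 \<le> height_at p (i + j)"
      using ij by (auto simp: path_intervals_def)
    have k: "i + (j - 1) < 2 * n" "Suc (i + (j - 1)) = i + j" "i + j < 2 * n" "Suc (i + j) = i + 1 + j"
      using b ij(2) by linarith+
    have "height_at p (i + j) \<le> height_at p (i + (j - 1)) + 1"
      using height_at_step[OF p k(1)] unfolding k(2) by linarith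
    moreover have "height_at p (i + j) \<le> height_at p (i + 1 + j) + 1"
      using height_at_step[OF p k(3)] unfolding k(4) by linarith
    ultimately show ?thesis using b ij(2) by (auto simp: path_intervals_def)
  qed
  then show ?thesis by (auto simp: interval_ideal_def path_intervals_def)
qed

definition interval_cell :: "nat \<times> nat \<Rightarrow> int \<times> int" where
  "interval_cell = (\<lambda>(i, j). (int i + int j, int j - int i + 1))"

lemma inj_interval_cell: "inj interval_cell"
  by (rule injI) (auto simp: interval_cell_def)

text \<open>The endpoints are \<open>(a - h + 1) / 2\<close> and \<open>(a + h - 1) / 2\<close>,
  integral by the parity of \<open>a + h\<close>; the slope bounds on the path give
  \<open>0 < i\<close> and \<open>j < n\<close>.\<close>

lemma cells_below_eq:
  assumes p: "dyck_path n p"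
  shows "cells_below p = interval_cell ` path_intervals n p"
proof (intro equalityI subrelI)
  fix a h assume "(a, h) \<in> cells_below p"
  then have c: "1 \<le> h" "odd (a + h)" "0 \<le> a" "a \<le> 2 * int n" "h + 1 \<le> height_at p (nat a)"
    using p by (auto simp: cells_below_def dyck_path_def)
  define i where "i = nat ((a - h + 1) div 2)"
  define j where "j = nat ((a + h - 1) div 2)"
  have "nat a \<le> 2 * n" using c(4) by linarith
  then have ah: "h + 1 \<le> a" "h + 1 \<le> 2 * int n - a"
    using c(3,5) height_at_bounds(2,3)[OF p, of "nat a"] by auto
  have ij: "2 * int i = a - h + 1" "2 * int j = a + h - 1"
  proof -
    have "2 * ((a - h + 1) div 2) = a - h + 1" "2 * ((a + h - 1) div 2) = a + h - 1"
      using c(2) by presburger+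
    then show "2 * int i = a - h + 1" "2 * int j = a + h - 1"
      using c(1) ah unfolding i_def j_def by linarith+
  qed
  have "nat a = i + j" using ij by linarith
  then have "(i, j) \<in> path_intervals n p" using ij c ah by (auto simp: path_intervals_def)
  moreover have "(a, h) = interval_cell (i, j)" using ij by (simp add: interval_cell_def)
  ultimately show "(a, h) \<in> interval_cell ` path_intervals n p" by blast
next
  fix a h assume "(a, h) \<in> interval_cell ` path_intervals n p"
  then obtain i j where "(i, j) \<in> path_intervals n p" "a = int i + int j" "h = int j - int i + 1"
    by (auto simp: interval_cell_def)
  then show "(a, h) \<in> cells_below p"
    using p by (auto simp: path_intervals_def cells_below_def dyck_path_def nat_add_distrib)
qed

text \<open>A height of at least \<open>2\<close> is recovered from the topmost cell below the path;
  heights \<open>0\<close> and \<open>1\<close> are told apart by parity.\<close>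

lemma inj_on_path_intervals: "inj_on (path_intervals n) {p. dyck_path n p}"
proof (rule inj_onI)
  have le: "height_at p k \<le> height_at q k"
    if p: "dyck_path n p" and q: "dyck_path n q" and eq: "path_intervals n p = path_intervals n q"
      and k: "k \<le> 2 * n" for p q k
  proof (cases "2 \<le> height_at p k")
    case True
    have "(int k, height_at p k - 1) \<in> cells_below p"
      using True k p height_at_bounds(4)[OF p k] by (auto simp: cells_below_def dyck_path_def)
    then have "(int k, height_at p k - 1) \<in> cells_below q"
      by (simp add: cells_below_eq[OF p] cells_below_eq[OF q] eq)
    then show ?thesis by (simp add: cells_below_def)
  next
    case False
    then show ?thesis
      using height_at_bounds(1,4)[OF p k] height_at_bounds(1,4)[OF q k] by presburger
  qed
  fix p q assume "p \<in> {p. dyck_path n p}" "q \<in> {p. dyck_path n p}" "path_intervals n p = path_intervals n q"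
  then show "p = q"
    using le[of p q] le[of q p] by (intro dyck_path_eqI[of n]) (auto intro: antisym)
qed

lemma dyck_path_of_heights:
  fixes H :: "nat \<Rightarrow> int"
  assumes "H 0 = 0" "H (2 * n) = 0" "\<And>k. k \<le> 2 * n \<Longrightarrow> 0 \<le> H k"
    and step: "\<And>k. k < 2 * n \<Longrightarrow> H (Suc k) = H k + 1 \<or> H (Suc k) = H k - 1"
  obtains p where "dyck_path n p" "\<And>k. k \<le> 2 * n \<Longrightarrow> height_at p k = H k"
proof -
  define p where "p = map (\<lambda>k. H (Suc k) - H k) [0..<2 * n]"
  have h: "height_at p k = H k" if "k \<le> 2 * n" for k
  proof -
    have "height_at p k = (\<Sum>i\<leftarrow>[0..<k]. H (Suc i) - H i)"
      using that by (simp add: height_at_def p_def take_map)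
    also have "\<dots> = H k" using assms(1) by (induction k) auto
    finally show ?thesis .
  qed
  have "set p \<subseteq> {1, -1}" using step by (fastforce simp: p_def)
  then have "dyck_path n p" using assms h by (auto simp: dyck_path_def p_def)
  then show ?thesis using that h by blast
qed

lemma path_intervals_surj:
  assumes I: "interval_ideal n I"
  obtains p where "dyck_path n p" "path_intervals n p = I"
proof -
  note ID = interval_idealD[OF I]
  have "finite I"
    by (rule finite_subset[of _ "{..n} \<times> {..n}"]) (use ID(1) in fastforce)+
  \<comment> \<open>Heights to be reached at abscissa \<open>a\<close>: the tops of the cells of
    \<open>I\<close> there, and the lowest zigzag \<open>a mod 2\<close>. The path is their upper
    outline.\<close>
  define A where "A a = insert (a mod 2) ((\<lambda>(i, j). j - i + 2) ` {(i, j) \<in> I. i + j = a})" for a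
  define K where "K a = Max (A a)" for a
  have fin: "finite (A a)" for a
    using finite_subset[OF _ \<open>finite I\<close>, of "{(i, j) \<in> I. i + j = a}"] by (auto simp: A_def)
  have K_ge: "a mod 2 \<le> K a" for a
    unfolding K_def by (rule Max_ge[OF fin]) (simp add: A_def)
  have K_ge_cell: "j - i + 2 \<le> K (i + j)" if "(i, j) \<in> I" for i j
    unfolding K_def by (rule Max_ge[OF fin]) (use that in \<open>force simp: A_def\<close>)
  have K_cases: "K a = a mod 2 \<or> (\<exists>i j. (i, j) \<in> I \<and> i + j = a \<and> K a = j - i + 2)" for a
  proof -
    have "K a \<in> A a" unfolding K_def by (rule Max_in[OF fin]) (simp add: A_def)
    then show ?thesis by (auto simp: A_def)
  qed
  have parity: "even (K a + a)" for a
    using K_cases[of a]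
  proof
    assume "\<exists>i j. (i, j) \<in> I \<and> i + j = a \<and> K a = j - i + 2"
    then obtain i j where "(i, j) \<in> I" "i + j = a" "K a = j - i + 2" by blast
    moreover from this have "i \<le> j" using ID(1) by blast
    ultimately have "K a + a = 2 * (j + 1)" by auto
    then show ?thesis by simp
  qed presburger
  have up: "K (Suc a) \<le> K a + 1" for a
    using K_cases[of "Suc a"]
  proof
    assume "K (Suc a) = Suc a mod 2"
    then show ?thesis using mod_less_divisor[of 2 "Suc a"] by linarith
  next
    assume "\<exists>i j. (i, j) \<in> I \<and> i + j = Suc a \<and> K (Suc a) = j - i + 2"
    then obtain i j where ij: "(i, j) \<in> I" "i + j = Suc a" "K (Suc a) = j - i + 2" by blast
    show ?thesis
    proof (cases "i < j")
      case True
      have "j - 1 - i + 2 \<le> K (i + (j - 1))" using K_ge_cell ID(2)[OF ij(1) True] by blast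
      moreover have "i + (j - 1) = a" using True ij(2) by linarith
      ultimately show ?thesis using True ij(3) by simp
    next
      case False
      then have "i = j" using ID(1)[OF ij(1)] by simp
      \<comment> \<open>A cell of height \<open>1\<close> has its top at height \<open>2\<close>,
        and next to it the zigzag alone reaches height \<open>1\<close>.\<close>
      then have "a mod 2 = 1" using ij(2) by presburger
      then show ?thesis using K_ge[of a] ij(3) \<open>i = j\<close> by simp
    qed
  qed
  have down: "K a \<le> K (Suc a) + 1" for a
    using K_cases[of a]
  proof
    assume "K a = a mod 2"
    then show ?thesis using mod_less_divisor[of 2 a] by linarith
  next
    assume "\<exists>i j. (i, j) \<in> I \<and> i + j = a \<and> K a = j - i + 2"
    then obtain i j where ij: "(i, j) \<in> I" "i + j = a" "K a = j - i + 2" by blast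
    show ?thesis
    proof (cases "i < j")
      case True
      have "j - (i + 1) + 2 \<le> K (i + 1 + j)" using K_ge_cell ID(3)[OF ij(1) True] by blast
      moreover have "i + 1 + j = Suc a" using ij(2) by linarith
      ultimately show ?thesis using True ij(3) by simp
    next
      case False
      then have "i = j" using ID(1)[OF ij(1)] by simp
      then have "Suc a mod 2 = 1" using ij(2) by presburger
      then show ?thesis using K_ge[of "Suc a"] ij(3) \<open>i = j\<close> by simp
    qed
  qed
  \<comment> \<open>Heights change by at most one, and parity forbids equal neighbours.\<close>
  have step: "int (K (Suc a)) = int (K a) + 1 \<or> int (K (Suc a)) = int (K a) - 1" for a
    using up[of a] down[of a] parity[of a] parity[of "Suc a"] by presburger
  have "K 0 = 0" using K_cases[of 0] ID(1) by auto
  moreover have "K (2 * n) = 0" using K_cases[of "2 * n"] ID(1) by fastforce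
  ultimately obtain p where p: "dyck_path n p" "\<And>k. k \<le> 2 * n \<Longrightarrow> height_at p k = int (K k)"
    using dyck_path_of_heights[of "\<lambda>k. int (K k)" n] step by auto
  have "(i, j) \<in> path_intervals n p \<longleftrightarrow> (i, j) \<in> I" for i j
  proof
    assume ij: "(i, j) \<in> I"
    then have "0 < i" "i \<le> j" "j < n" using ID(1) by auto
    then show "(i, j) \<in> path_intervals n p"
      using K_ge_cell[OF ij] p(2)[of "i + j"] by (auto simp: path_intervals_def)
  next
    assume "(i, j) \<in> path_intervals n p"
    then have ij: "0 < i" "i \<le> j" "j < n" "int j - int i + 2 \<le> int (K (i + j))"
      using p(2)[of "i + j"] by (auto simp: path_intervals_def)
    then have "K (i + j) \<noteq> (i + j) mod 2"
      using mod_less_divisor[of 2 "i + j"] by linarith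
    then obtain i' j' where ij': "(i', j') \<in> I" "i' + j' = i + j" "K (i + j) = j' - i' + 2"
      using K_cases by blast
    have "i' \<le> j'" using ID(1)[OF ij'(1)] by simp
    \<comment> \<open>Intervals with the same sum of endpoints are concentric, so the longer one
      contains \<open>[i, j]\<close>.\<close>
    then have "i' \<le> i" "j \<le> j'" using ij ij' by linarith+
    then show "(i, j) \<in> I" using interval_ideal_sub[OF I ij'(1)] ij by blast
  qed
  then have "path_intervals n p = I" by auto
  then show ?thesis using that p(1) by blast
qed

text \<open>The cells across the upper right and upper left edges of \<open>[i, j]\<close> are
  \<open>[i, j + 1]\<close> and \<open>[i - 1, j]\<close>; an upper edge lies on the path exactly if
  the cell across it is not below the path.\<close>

lemma wt_interval_cell:
  assumes p: "dyck_path n p" and ij: "(i, j) \<in> path_intervals n p"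
  shows "wt p (interval_cell (i, j)) = card (choices (path_intervals n p) (i, j))"
proof -
  let ?a = "i + j" and ?h = "int j - int i + 1" and ?H = "height_at p"
  have b: "0 < i" "i \<le> j" "j < n" "?h + 1 \<le> ?H ?a" using ij by (auto simp: path_intervals_def)
  have len: "length p = 2 * n" using p by (simp add: dyck_path_def)
  define a where "a = i + j - 1"
  have a: "i + j = Suc a" "int i + int j = 1 + int a" using b by (auto simp: a_def)
  note B = height_at_bounds[OF p, of "i + j"] height_at_bounds[OF p, of "Suc (i + j)"] height_at_bounds[OF p, of a]
  have steps: "((int k, x), (int (Suc k), y)) \<in> path_steps p \<longleftrightarrow> k < 2 * n \<and> x = ?H k \<and> y = ?H (Suc k)" for k x y
    by (auto simp: path_steps_def len)
  have ur: "upper_right_edge (interval_cell (i, j)) \<in> path_steps p \<longleftrightarrow> (i, j + 1) \<notin> path_intervals n p"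
  proof -
    have "upper_right_edge (interval_cell (i, j)) = ((int ?a, ?h + 1), (int (Suc ?a), ?h))"
      by (simp add: upper_right_edge_def interval_cell_def)
    then have "upper_right_edge (interval_cell (i, j)) \<in> path_steps p \<longleftrightarrow> ?h + 1 = ?H ?a \<and> ?h = ?H (Suc ?a)"
      using steps[of ?a "?h + 1" ?h] b by simp
    also have "\<dots> \<longleftrightarrow> \<not> ?h + 2 \<le> ?H (Suc ?a)"
      using height_at_step[OF p, of ?a] B(8) b by auto presburger+
    \<comment> \<open>If the height reaches \<open>j - i + 3\<close> here, its bound by the number
      of remaining steps gives \<open>j + 1 < n\<close>.\<close>
    also have "\<dots> \<longleftrightarrow> (i, j + 1) \<notin> path_intervals n p"
      using B(7) b by (auto simp: path_intervals_def)
    finally show ?thesis .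
  qed
  have ul: "upper_left_edge (interval_cell (i, j)) \<in> path_steps p \<longleftrightarrow> (i - 1, j) \<notin> path_intervals n p"
  proof -
    have "upper_left_edge (interval_cell (i, j)) = ((int a, ?h), (int (Suc a), ?h + 1))"
      using a by (simp add: upper_left_edge_def interval_cell_def)
    then have "upper_left_edge (interval_cell (i, j)) \<in> path_steps p \<longleftrightarrow> ?h = ?H a \<and> ?h + 1 = ?H (Suc a)"
      using steps[of a ?h "?h + 1"] b a by simp
    also have "\<dots> \<longleftrightarrow> \<not> ?h + 2 \<le> ?H a"
      using height_at_step[OF p, of a] B(12) b a by auto presburger+
    also have "\<dots> \<longleftrightarrow> (i - 1, j) \<notin> path_intervals n p"
    proof -
      have e: "i - 1 + j = a" "int (i - 1) = int i - 1" using b a by auto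
      have "?H a \<le> int a" using B(10) b a by simp
      then show ?thesis
        using b a unfolding path_intervals_def mem_Collect_eq case_prod_conv e by linarith
    qed
    finally show ?thesis .
  qed
  have "snd (interval_cell (i, j)) = 1 \<longleftrightarrow> i = j" by (auto simp: interval_cell_def)
  then show ?thesis
    unfolding wt_def corner_cell_def boundary_cell_def ur ul card_choices by auto
qed

text \<open>Closed sets are sorted by support; each support is an ideal of intervals and comes from
  exactly one Dyck path.\<close>

lemma card_closed_conditions: "card (closed_conditions n) = (\<Sum>p | dyck_path n p. path_weight p)"
proof -
  let ?F = "\<lambda>p. {N \<in> closed_conditions n. condition_support N = path_intervals n p}"
  have fin: "finite (closed_conditions n)"
  proof (rule finite_subset)
    show "closed_conditions n \<subseteq> Pow (conditions n)" unfolding closed_conditions_def by blast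
    have "conditions n \<subseteq> {..n} \<times> {..n}" by (auto simp: conditions_def)
    then show "finite (Pow (conditions n))" by (simp add: finite_subset)
  qed
  have "closed_conditions n = (\<Union>p\<in>{p. dyck_path n p}. ?F p)"
  proof (intro equalityI subsetI)
    fix N assume N: "N \<in> closed_conditions n"
    obtain p where "dyck_path n p" "path_intervals n p = condition_support N"
      using path_intervals_surj[OF condition_support_ideal[OF N]] by blast
    then show "N \<in> (\<Union>p\<in>{p. dyck_path n p}. ?F p)" using N by auto
  qed auto
  also have "card \<dots> = (\<Sum>p | dyck_path n p. card (?F p))"
  proof (rule card_UN_disjoint[OF finite_dyck_paths])
    show "\<forall>p\<in>{p. dyck_path n p}. \<forall>q\<in>{p. dyck_path n p}. p \<noteq> q \<longrightarrow> ?F p \<inter> ?F q = {}"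
      using inj_on_path_intervals[of n] by (auto simp: inj_on_def)
  qed (use fin in auto)
  also have "\<dots> = (\<Sum>p | dyck_path n p. path_weight p)"
  proof (rule sum.cong)
    fix p assume "p \<in> {p. dyck_path n p}"
    then have p: "dyck_path n p" by simp
    have "path_weight p = (\<Prod>c\<in>path_intervals n p. wt p (interval_cell c))"
      unfolding path_weight_def cells_below_eq[OF p]
      by (rule prod.reindex_cong[OF inj_on_subset[OF inj_interval_cell subset_UNIV]]) auto
    also have "\<dots> = (\<Prod>c\<in>path_intervals n p. card (choices (path_intervals n p) c))"
      using wt_interval_cell[OF p] by (intro prod.cong) auto
    also have "\<dots> = card (?F p)"
      using card_closed_conditions_support[OF path_intervals_ideal[OF p]] by simp
    finally show "card (?F p) = path_weight p" by simp
  qed simp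
  finally show ?thesis .
qed

theorem proposition10p13:
  fixes n :: nat
  assumes "n \<ge> 1"
  shows "card (carrier (congruence_lattice (sTam n))) = (\<Sum>p | dyck_path n p. path_weight p)"
  using card_congruence_lattice_sTam[OF assms] card_arrow_congs card_closed_conditions by simp

end
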